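(* Let $H$ be a connected graph with no conical vertex and containing at least one pendant edge, and suppose $H$ is not a copy of $K_r$ with a rotated edge for any odd $r\geq 5$. Then for every integer $t\geq |H|^2$, $\operatorname{sat}_t(n,\mathfrak{R}(H))=\Theta(n)$ as $n\to\infty$.
   Context: A $t$-edge-coloured graph is a graph $G$ with a function $c:E(G)\to\{1,\dots,t\}$ (not necessarily proper). A copy of $H$ is rainbow if all its edges receive distinct colours; $\mathfrak{R}(H)$ denotes the family of rainbow copies of $H$. A $t$-edge-coloured graph is $\mathfrak{R}(H)$-saturated if it contains no rainbow copy of $H$ but adding any non-edge in any colour from $\{1,\dots,t\}$ creates a rainbow copy of $H$. $\operatorname{sat}_t(n,\mathfrak{R}(H))$ is the minimum number of edges of such a graph on $n$ vertices. A vertex of $H$ is conical if its degree is $|H|-1$. An edge is pendant if one of its endpoints has degree $1$. For $r\geq 4$, "$K_r$ with a rotated edge" is obtained from a copy of $K_r$ by adding one new vertex $w$ and replacing one edge $uv$ of the clique by the edge $uw$. *)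

theory Defs
  imports Complex_Main "HOL-Library.Landau_Symbols"
begin

record 'a ugraph =
  vertices :: "'a set"
  edges :: "'a set set"

definition pairs :: "'a set \<Rightarrow> 'a set set" where
  "pairs V = {e. e \<subseteq> V \<and> card e = 2}"

definition simple_graph :: "'a ugraph \<Rightarrow> bool" where
  "simple_graph G \<longleftrightarrow> finite (vertices G) \<and> edges G \<subseteq> pairs (vertices G)"

definition degree :: "'a ugraph \<Rightarrow> 'a \<Rightarrow> nat" where
  "degree G v = card {e \<in> edges G. v \<in> e}"

definition connected_graph :: "'a ugraph \<Rightarrow> bool" where
  "connected_graph G \<longleftrightarrow> vertices G \<noteq> {} \<and>
     (\<forall>u\<in>vertices G. \<forall>v\<in>vertices G. (u, v) \<in> {(x, y). {x, y} \<in> edges G}\<^sup>*)"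

definition conical_vertex :: "'a ugraph \<Rightarrow> 'a \<Rightarrow> bool" where
  "conical_vertex G v \<longleftrightarrow> v \<in> vertices G \<and> degree G v = card (vertices G) - 1"

definition pendant_edge :: "'a ugraph \<Rightarrow> 'a set \<Rightarrow> bool" where
  "pendant_edge G e \<longleftrightarrow> e \<in> edges G \<and> (\<exists>v\<in>e. degree G v = 1)"

text \<open>
  \<open>rotated_clique r G\<close>: the graph \<open>G\<close> is a copy of \<open>K\<^sub>r\<close> with a rotated edge. The clique \<open>K\<close> is an
  arbitrary \<open>r\<close>-element set, so the property is invariant under isomorphism.
\<close>
definition rotated_clique :: "nat \<Rightarrow> 'a ugraph \<Rightarrow> bool" where
  "rotated_clique r G \<longleftrightarrow> r \<ge> 4 \<and>
     (\<exists>K u v w. finite K \<and> card K = r \<and> u \<in> K \<and> v \<in> K \<and> u \<noteq> v \<and> w \<notin> K \<and>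
        vertices G = insert w K \<and>
        edges G = insert {u, w} (pairs K - {{u, v}}))"

definition subgraph :: "'a ugraph \<Rightarrow> 'a ugraph \<Rightarrow> bool" where
  "subgraph F G \<longleftrightarrow> vertices F \<subseteq> vertices G \<and> edges F \<subseteq> edges G"

definition copy_of :: "'a ugraph \<Rightarrow> 'b ugraph \<Rightarrow> bool" where
  "copy_of H F \<longleftrightarrow>
     (\<exists>f. bij_betw f (vertices H) (vertices F) \<and> edges F = (\<lambda>e. f ` e) ` edges H)"

text \<open>
  A colouring is a total function on sets of vertices; only its values on the edges matter.
\<close>
definition edge_colouring :: "nat \<Rightarrow> 'b ugraph \<Rightarrow> ('b set \<Rightarrow> nat) \<Rightarrow> bool" where
  "edge_colouring t G c \<longleftrightarrow> (\<forall>e\<in>edges G. c e \<in> {1..t})"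

definition has_rainbow_copy :: "'a ugraph \<Rightarrow> 'b ugraph \<Rightarrow> ('b set \<Rightarrow> nat) \<Rightarrow> bool" where
  "has_rainbow_copy H G c \<longleftrightarrow> (\<exists>F. subgraph F G \<and> copy_of H F \<and> inj_on c (edges F))"

definition rainbow_saturated ::
    "nat \<Rightarrow> 'a ugraph \<Rightarrow> 'b ugraph \<Rightarrow> ('b set \<Rightarrow> nat) \<Rightarrow> bool" where
  "rainbow_saturated t H G c \<longleftrightarrow>
     simple_graph G \<and> edge_colouring t G c \<and> \<not> has_rainbow_copy H G c \<and>
     (\<forall>e \<in> pairs (vertices G) - edges G. \<forall>k\<in>{1..t}.
        has_rainbow_copy H (G\<lparr>edges := insert e (edges G)\<rparr>) (c(e := k)))"

text \<open>
  Every finite graph is isomorphic to one with natural numbers as vertices, so host graphs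
  may be taken over \<^typ>\<open>nat\<close>. The set minimised over is nonempty whenever \<open>t \<ge> 1\<close> and \<open>H\<close> has at
  least two edges; see \<open>rainbow_saturated_exists\<close>.
\<close>
definition rainbow_sat :: "nat \<Rightarrow> nat \<Rightarrow> 'a ugraph \<Rightarrow> nat" where
  "rainbow_sat t n H = (LEAST m. \<exists>(G :: nat ugraph) c.
     card (vertices G) = n \<and> rainbow_saturated t H G c \<and> card (edges G) = m)"

lemma rainbow_saturated_exists:
  assumes "simple_graph H" "card (edges H) \<ge> 2" "t \<ge> 1"
  shows "\<exists>(G :: nat ugraph) c. card (vertices G) = n \<and> rainbow_saturated t H G c"
proof (intro exI conjI)
  let ?G = "\<lparr>vertices = {..<n}, edges = pairs {..<n}\<rparr>"
  let ?c = "\<lambda>_ :: nat set. 1 :: nat"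
  show "card (vertices ?G) = n" by simp
  have "\<not> has_rainbow_copy H ?G ?c"
  proof
    assume "has_rainbow_copy H ?G ?c"
    then obtain F :: "nat ugraph" and f where f: "bij_betw f (vertices H) (vertices F)"
      and E: "edges F = (\<lambda>e. f ` e) ` edges H" and i: "inj_on ?c (edges F)"
      unfolding has_rainbow_copy_def copy_of_def by blast
    have "inj_on (\<lambda>e. f ` e) (edges H)"
    proof (rule inj_on_subset)
      show "inj_on (\<lambda>e. f ` e) (Pow (vertices H))"
        using f by (simp add: bij_betw_def inj_on_image_Pow)
      show "edges H \<subseteq> Pow (vertices H)"
        using assms(1) by (auto simp: simple_graph_def pairs_def)
    qed
    then have "card (edges F) \<ge> 2" using assms(2) E by (simp add: card_image)
    moreover have "card (?c ` edges F) \<le> card {1 :: nat}" by (rule card_mono) auto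
    ultimately show False using card_image[OF i] by simp
  qed
  then show "rainbow_saturated t H ?G ?c"
    using assms(3) by (simp add: rainbow_saturated_def simple_graph_def edge_colouring_def)
qed

end

(* Lower bound: in a saturated graph two isolated vertices would become an isolated edge after
   joining them, and H is connected on more than two vertices; so at most one vertex is isolated.

   Upper bound: it suffices to find a coloured graph without rainbow H and a set B of O(n) pairs
   that contains its edges, such that any pair outside B, added in any colour, creates a rainbow H;
   a saturated graph is then reached by adding edges of B only. Let v be a leaf of H with
   neighbour u, let K be the set of the other vertices, and let d be the number of neighbours of u
   in K; since u is not conical, 1 <= d < |K|.
   - If K is not a clique or d = 1, take disjoint rainbow cliques on |H| - 1 vertices: the non-edges
     of H leave enough room to avoid the edge that has the colour of the new edge.
   - If K is a clique and 2 <= d <= |K| - 2, take two rainbow cliques on |K| vertices with disjoint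
     palettes and join every other vertex to d + 1 vertices of each by colours of the other clique.
   - If K is a clique and d = |K| - 1, then H is K_r with a rotated edge for r = |K| + 1, so r is
     even. Take disjoint Hamming graphs [r]^(r/2), whose lines are the copies of K_r. Along direction
     a the lines are coloured by a one-factorisation in which each perfect matching is rotated by a.
     So the colours of a vertex's edges in one direction reappear away from it on its lines in
     the other directions, and every colour is missing away from the vertex on some line. *)
theory Submission
  imports Defs "HOL-Library.FuncSet"
begin

section \<open>Rainbow copies as injective maps, and greedy completion to a saturated graph\<close>

section \<open>Rainbow embeddings and saturated extensions\<close>

text \<open>Being rainbow is tested on the edges of \<open>H\<close> instead of on an image
  subgraph, so a construction only has to supply a map on vertices.\<close>

definition rainbow_embedding :: "'a ugraph \<Rightarrow> 'b ugraph \<Rightarrow> ('b set \<Rightarrow> nat) \<Rightarrow> ('a \<Rightarrow> 'b) \<Rightarrow> bool" where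
  "rainbow_embedding H G c f \<longleftrightarrow>
     inj_on f (vertices H) \<and> f ` vertices H \<subseteq> vertices G \<and>
     (\<forall>e\<in>edges H. f ` e \<in> edges G) \<and> inj_on (\<lambda>e. c (f ` e)) (edges H)"

lemma simple_graphD:
  assumes "simple_graph G" "e \<in> edges G"
  shows "e \<subseteq> vertices G" "card e = 2"
  using assms by (auto simp: simple_graph_def pairs_def)

lemma pair_in_pairs_iff [simp]: "{x, y} \<in> pairs V \<longleftrightarrow> x \<in> V \<and> y \<in> V \<and> x \<noteq> y"
  by (auto simp: pairs_def card_insert_if)

lemma pairsE:
  assumes "e \<in> pairs V"
  obtains x y where "e = {x, y}" "x \<in> V" "y \<in> V" "x \<noteq> y"
  using assms by (auto simp: pairs_def card_2_iff)

lemma finite_pairs: "finite V \<Longrightarrow> finite (pairs V)"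
  by (auto simp: pairs_def)

lemma pairs_mono: "V \<subseteq> W \<Longrightarrow> pairs V \<subseteq> pairs W"
  by (auto simp: pairs_def)

lemma pairs_image:
  assumes "inj_on f V" "e \<in> pairs V"
  shows "f ` e \<in> pairs (f ` V)"
  using assms by (auto elim!: pairsE simp: inj_on_eq_iff)

lemma inj_on_image_pairs: "inj_on f V \<Longrightarrow> inj_on ((`) f) (pairs V)"
  by (rule inj_on_subset[of _ "Pow V"]) (auto simp: inj_on_image_Pow pairs_def)

text \<open>A map injective on the vertices is also injective on the edges of a simple graph, so
  distinct colours on the image and distinct colours indexed by \<open>edges H\<close> amount to the
  same.\<close>

lemma has_rainbow_copy_iff:
  assumes H: "simple_graph H"
  shows "has_rainbow_copy H G c \<longleftrightarrow> (\<exists>f. rainbow_embedding H G c f)"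
proof
  have sub: "edges H \<subseteq> pairs (vertices H)"
    using H by (simp add: simple_graph_def)
  {
    assume "has_rainbow_copy H G c"
    then obtain F f where F: "subgraph F G" "inj_on c (edges F)"
      and f: "bij_betw f (vertices H) (vertices F)" "edges F = (\<lambda>e. f ` e) ` edges H"
      unfolding has_rainbow_copy_def copy_of_def by blast
    have "inj_on ((`) f) (edges H)"
      using inj_on_image_pairs sub f(1) by (metis bij_betw_imp_inj_on inj_on_subset)
    then have "inj_on (c \<circ> (`) f) (edges H)"
      using F(2) f(2) by (simp add: comp_inj_on)
    then show "\<exists>f. rainbow_embedding H G c f"
      using F(1) f by (intro exI[of _ f])
        (auto simp: rainbow_embedding_def subgraph_def bij_betw_def comp_def)
  }
  assume "\<exists>f. rainbow_embedding H G c f"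
  then obtain f where f: "rainbow_embedding H G c f" by blast
  let ?F = "\<lparr>vertices = f ` vertices H, edges = (\<lambda>e. f ` e) ` edges H\<rparr>"
  have "inj_on c (edges ?F)"
    using f unfolding rainbow_embedding_def inj_on_def by (auto 0 3)
  then show "has_rainbow_copy H G c"
    using f unfolding has_rainbow_copy_def copy_of_def
    by (intro exI[of _ ?F]) (auto simp: rainbow_embedding_def subgraph_def bij_betw_def)
qed

lemma has_rainbow_copy_mono:
  assumes "has_rainbow_copy H G c" "subgraph G G'" "\<And>e. e \<in> edges G \<Longrightarrow> c' e = c e"
  shows "has_rainbow_copy H G' c'"
proof -
  obtain F where F: "subgraph F G" "copy_of H F" "inj_on c (edges F)"
    using assms(1) by (auto simp: has_rainbow_copy_def)
  have "inj_on c' (edges F)"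
    using F(1,3) assms(3) by (auto simp: inj_on_def subgraph_def subset_eq)
  moreover have "subgraph F G'"
    using F(1) assms(2) by (auto simp: subgraph_def)
  ultimately show ?thesis
    using F(2) by (auto simp: has_rainbow_copy_def)
qed

text \<open>Transport along a relabelling of vertices; it is applied in both directions when a host
  graph is moved to natural numbers.\<close>

lemma has_rainbow_copy_image:
  assumes H: "simple_graph H" and "simple_graph G" "has_rainbow_copy H G c"
    and g: "inj_on g (vertices G)"
    and c': "\<And>e. e \<in> edges G \<Longrightarrow> c' (g ` e) = c e"
  shows "has_rainbow_copy H \<lparr>vertices = g ` vertices G, edges = (`) g ` edges G\<rparr> c'"
proof -
  obtain f where f: "rainbow_embedding H G c f"
    using assms has_rainbow_copy_iff by blast
  have "inj_on (g \<circ> f) (vertices H)"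
    using f g by (intro comp_inj_on) (auto simp: rainbow_embedding_def intro: inj_on_subset)
  moreover have comp: "(g \<circ> f) ` e = g ` f ` e" for e
    by (simp add: image_comp)
  have "inj_on (\<lambda>e. c' ((g \<circ> f) ` e)) (edges H)"
    unfolding comp using f c' by (simp add: rainbow_embedding_def inj_on_def)
  ultimately have "rainbow_embedding H \<lparr>vertices = g ` vertices G, edges = (`) g ` edges G\<rparr> c' (g \<circ> f)"
    unfolding rainbow_embedding_def comp using f by (auto simp: rainbow_embedding_def)
  then show ?thesis
    using has_rainbow_copy_iff[OF H] by blast
qed

text \<open>As long as the graph is not saturated, some non-edge can be added in some colour without
  a rainbow copy, and the last hypothesis forces this pair into \<open>B\<close>. The number of
  non-edges drops each time.\<close>

lemma ex_saturated_extension: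
  assumes "simple_graph G" "edge_colouring t G c" "\<not> has_rainbow_copy H G c" "edges G \<subseteq> B"
    and "\<And>e k. \<lbrakk>e \<in> pairs (vertices G) - B; k \<in> {1..t}\<rbrakk> \<Longrightarrow>
      has_rainbow_copy H (G\<lparr>edges := insert e (edges G)\<rparr>) (c(e := k))"
  shows "\<exists>G' c'. vertices G' = vertices G \<and> edges G' \<subseteq> B \<and> rainbow_saturated t H G' c'"
  using assms
proof (induction "card (pairs (vertices G) - edges G)" arbitrary: G c rule: less_induct)
  case less
  show ?case
  proof (cases "rainbow_saturated t H G c")
    case False
    then obtain e k where ek: "e \<in> pairs (vertices G) - edges G" "k \<in> {1..t}"
      "\<not> has_rainbow_copy H (G\<lparr>edges := insert e (edges G)\<rparr>) (c(e := k))"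
      using less.prems by (auto simp: rainbow_saturated_def)
    let ?G = "G\<lparr>edges := insert e (edges G)\<rparr>"
    have eB: "e \<in> B" using ek less.prems(5) by blast
    have "finite (pairs (vertices G))"
      using less.prems(1) by (simp add: simple_graph_def finite_pairs)
    then have "card (pairs (vertices ?G) - edges ?G) < card (pairs (vertices G) - edges G)"
      using ek(1) by (intro psubset_card_mono) auto
    moreover have "simple_graph ?G"
      using less.prems(1) ek(1) by (auto simp: simple_graph_def)
    moreover have "edge_colouring t ?G (c(e := k))"
      using less.prems(2) ek by (auto simp: edge_colouring_def)
    moreover have "edges ?G \<subseteq> B"
      using less.prems(4) eB by auto
    \<comment> \<open>\<open>e\<close> is a non-edge of \<open>G\<close> inside \<open>B\<close> and
      \<open>e'\<close> is outside \<open>B\<close>, so adding and recolouring \<open>e\<close> does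
      not disturb the rainbow copy in \<open>G\<close> plus \<open>e'\<close>.\<close>
    moreover have "has_rainbow_copy H (?G\<lparr>edges := insert e' (edges ?G)\<rparr>) ((c(e := k))(e' := k'))"
      if "e' \<in> pairs (vertices ?G) - B" "k' \<in> {1..t}" for e' k'
    proof (rule has_rainbow_copy_mono)
      show "has_rainbow_copy H (G\<lparr>edges := insert e' (edges G)\<rparr>) (c(e' := k'))"
        using that less.prems(5) by simp
    qed (use ek eB that in \<open>auto simp: subgraph_def\<close>)
    ultimately have "\<exists>G' c'. vertices G' = vertices ?G \<and> edges G' \<subseteq> B \<and> rainbow_saturated t H G' c'"
      using ek(3) by (intro less.hyps) auto
    then show ?thesis by simp
  qed (use less.prems in blast)
qed

text \<open>\<open>rainbow_sat\<close> minimises over graphs on \<open>nat\<close>, while the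
  constructions live on pairs and functions; an injection into \<open>nat\<close> carries saturation
  over.\<close>

lemma rainbow_sat_le:
  fixes G :: "'b ugraph"
  assumes H: "simple_graph H" and G: "rainbow_saturated t H G c"
  shows "rainbow_sat t (card (vertices G)) H \<le> card (edges G)"
proof -
  have sG: "simple_graph G" and fin: "finite (vertices G)"
    using G by (auto simp: rainbow_saturated_def simple_graph_def)
  obtain g :: "'b \<Rightarrow> nat" where g: "inj_on g (vertices G)"
    using fin finite_imp_inj_to_nat_seg by blast
  define g' where "g' = the_inv_into (vertices G) g"
  have g'g: "g' ` g ` e = e" if "e \<subseteq> vertices G" for e
    using that g by (force simp: g'_def the_inv_into_f_f subset_eq)
  have g'V: "g' ` g ` vertices G = vertices G" by (simp add: g'g)
  have gg': "g ` g' ` e = e" if "e \<subseteq> g ` vertices G" for e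
    using that g by (force simp: g'_def f_the_inv_into_f subset_eq)
  have injg': "inj_on g' (g ` vertices G)"
    unfolding g'_def using g by (simp add: inj_on_the_inv_into)
  let ?G = "\<lparr>vertices = g ` vertices G, edges = (`) g ` edges G\<rparr>"
  let ?c = "\<lambda>e. c (g' ` e)"
  have sub: "edges G \<subseteq> pairs (vertices G)"
    using sG by (simp add: simple_graph_def)
  have edge_sub: "e \<subseteq> vertices G" if "e \<in> edges G" for e
    using sub that by (auto simp: pairs_def)
  have g'gE: "(`) g' ` (`) g ` edges G = edges G"
    using edge_sub g'g by (force simp: image_image)
  have s: "simple_graph ?G"
    using fin sub pairs_image[OF g] by (auto simp: simple_graph_def)
  have "card ((`) g ` edges G) = card (edges G)"
    using sub inj_on_image_pairs[OF g] by (intro card_image) (rule inj_on_subset)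
  moreover have "rainbow_saturated t H ?G ?c"
    unfolding rainbow_saturated_def
  proof (intro conjI ballI)
    show "simple_graph ?G" by (rule s)
    show "edge_colouring t ?G ?c"
      using G edge_sub by (auto simp: rainbow_saturated_def edge_colouring_def g'g)
    show "\<not> has_rainbow_copy H ?G ?c"
    \<comment> \<open>A copy in the relabelled graph is pulled back along the inverse
      \<open>g'\<close>.\<close>
    proof
      assume "has_rainbow_copy H ?G ?c"
      from has_rainbow_copy_image[OF H s this, of g' c] injg'
      have "has_rainbow_copy H \<lparr>vertices = vertices G, edges = edges G\<rparr> c"
        by (simp add: g'gE g'V)
      moreover have "\<lparr>vertices = vertices G, edges = edges G\<rparr> = G"
        by (cases G) simp
      ultimately show False
        using G by (simp add: rainbow_saturated_def)
    qed
    fix e k assume e: "e \<in> pairs (vertices ?G) - edges ?G" and k: "k \<in> {1..t}"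
    have eV: "e \<subseteq> g ` vertices G" using e by (auto simp: pairs_def)
    have e': "g' ` e \<in> pairs (vertices G)"
      using pairs_image[OF injg'] e g'V by auto
    moreover have "g' ` e \<notin> edges G"
      using e imageI[of "g' ` e" "edges G" "(`) g"] gg'[OF eV] by auto
    ultimately have "has_rainbow_copy H (G\<lparr>edges := insert (g' ` e) (edges G)\<rparr>) (c(g' ` e := k))"
      using G k by (simp add: rainbow_saturated_def)
    moreover have "simple_graph (G\<lparr>edges := insert (g' ` e) (edges G)\<rparr>)"
      using sG e' by (simp add: simple_graph_def)
    moreover have "(?c(e := k)) (g ` e0) = (c(g' ` e := k)) e0"
      if "e0 \<in> insert (g' ` e) (edges G)" for e0
    proof -
      have "e0 \<subseteq> vertices G" using that e' edge_sub by (auto simp: pairs_def)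
      then have 1: "g' ` g ` e0 = e0" by (rule g'g)
      then have 2: "g ` e0 = e \<longleftrightarrow> e0 = g' ` e" using gg'[OF eV] by metis
      show ?thesis by (simp only: fun_upd_apply 1 2)
    qed
    ultimately have "has_rainbow_copy H
        \<lparr>vertices = g ` vertices G, edges = (`) g ` insert (g' ` e) (edges G)\<rparr> (?c(e := k))"
      using has_rainbow_copy_image[OF H, of "G\<lparr>edges := insert (g' ` e) (edges G)\<rparr>"
        "c(g' ` e := k)" g "?c(e := k)"] g by simp
    then show "has_rainbow_copy H (?G\<lparr>edges := insert e (edges ?G)\<rparr>) (?c(e := k))"
      using gg'[OF eV] by simp
  qed
  ultimately show ?thesis
    unfolding rainbow_sat_def using card_image[OF g]
    by (intro Least_le) (rule exI[of _ ?G], rule exI[of _ ?c], simp)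
qed

text \<open>The form in which every upper bound is obtained: the starting graph may be far from
  saturated, only the size of \<open>B\<close> counts.\<close>

lemma rainbow_sat_le_card:
  assumes "simple_graph H" "simple_graph G" "edge_colouring t G c" "\<not> has_rainbow_copy H G c"
    and "edges G \<subseteq> B" "finite B"
    and "\<And>e k. \<lbrakk>e \<in> pairs (vertices G) - B; k \<in> {1..t}\<rbrakk> \<Longrightarrow>
      has_rainbow_copy H (G\<lparr>edges := insert e (edges G)\<rparr>) (c(e := k))"
  shows "rainbow_sat t (card (vertices G)) H \<le> card B"
proof -
  obtain G' c' where G': "vertices G' = vertices G" "edges G' \<subseteq> B" "rainbow_saturated t H G' c'"
    using ex_saturated_extension[OF assms(2-5,7)] by blast
  have "rainbow_sat t (card (vertices G)) H \<le> card (edges G')"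
    using rainbow_sat_le[OF assms(1) G'(3)] G'(1) by simp
  also have "\<dots> \<le> card B"
    using G'(2) assms(6) by (rule card_mono[rotated])
  finally show ?thesis .
qed

section \<open>Lower bound through the isolated vertices of a saturated graph\<close>

section \<open>The lower bound\<close>

text \<open>Induction along a path; it also serves to show that a quantity preserved by every edge
  is constant on \<open>H\<close>.\<close>

lemma connected_graph_closed:
  assumes "connected_graph H" "a \<in> S" "a \<in> vertices H"
    and "\<And>x y. \<lbrakk>x \<in> S; {x, y} \<in> edges H\<rbrakk> \<Longrightarrow> y \<in> S"
  shows "vertices H \<subseteq> S"
proof
  fix b assume "b \<in> vertices H"
  then have "(a, b) \<in> {(x, y). {x, y} \<in> edges H}\<^sup>*"
    using assms by (auto simp: connected_graph_def)
  then show "b \<in> S"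
    by induction (use assms in auto)
qed

text \<open>A rainbow copy created by joining two isolated vertices would contain the new edge as a
  whole component, so the connected graph \<open>H\<close> would have only two vertices.\<close>

lemma rainbow_saturated_isolated_unique:
  assumes H: "simple_graph H" "connected_graph H" "card (vertices H) \<ge> 3" and "t \<ge> 1"
    and G: "rainbow_saturated t H G c"
    and x: "x \<in> vertices G - \<Union>(edges G)" and y: "y \<in> vertices G - \<Union>(edges G)"
  shows "x = y"
proof (rule ccontr)
  assume ne: "x \<noteq> y"
  let ?G = "G\<lparr>edges := insert {x, y} (edges G)\<rparr>"
  have "has_rainbow_copy H ?G (c({x, y} := 1))"
  proof -
    have "{x, y} \<in> pairs (vertices G) - edges G" "1 \<in> {1..t}"
      using x y ne \<open>t \<ge> 1\<close> by auto
    then show ?thesis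
      using G unfolding rainbow_saturated_def by blast
  qed
  then obtain f where f: "rainbow_embedding H ?G (c({x, y} := 1)) f"
    using has_rainbow_copy_iff[OF H(1)] by blast
  have inj: "inj_on f (vertices H)" using f by (simp add: rainbow_embedding_def)
  have no: "\<not> has_rainbow_copy H G c" using G by (simp add: rainbow_saturated_def)
  \<comment> \<open>A copy that avoids the new edge would already be a rainbow copy in
    \<open>G\<close>.\<close>
  have "\<exists>e\<in>edges H. f ` e = {x, y}"
  proof (rule ccontr)
    assume *: "\<not> ?thesis"
    then have "inj_on (\<lambda>e. c (f ` e)) (edges H)"
      using f by (auto simp: rainbow_embedding_def inj_on_def)
    then have "rainbow_embedding H G c f"
      using f * by (auto simp: rainbow_embedding_def)
    then show False using no has_rainbow_copy_iff[OF H(1)] by blast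
  qed
  then obtain e where e: "e \<in> edges H" "f ` e = {x, y}" by blast
  have eV: "e \<subseteq> vertices H" "card e = 2"
    using simple_graphD[OF H(1) e(1)] by auto
  obtain a where a: "a \<in> e" using eV(2) by fastforce
  have "vertices H \<subseteq> e"
  proof (rule connected_graph_closed[OF H(2) a])
    fix p q assume p: "p \<in> e" and pq: "{p, q} \<in> edges H"
    have "\<forall>e\<in>edges H. f ` e \<in> insert {x, y} (edges G)"
      using f by (simp add: rainbow_embedding_def)
    then have "f ` {p, q} \<in> insert {x, y} (edges G)"
      using pq by (rule bspec)
    moreover have "f p \<in> {x, y}" using p e by blast
    \<comment> \<open>No edge of \<open>G\<close> meets \<open>x\<close> or \<open>y\<close>, so an
      edge that meets the image of \<open>e\<close> is the new edge itself.\<close>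
    ultimately have "f ` {p, q} = f ` e"
      using x y e by auto
    then have "{p, q} = e"
      using inj_on_image_eq_iff[OF inj _ eV(1)] simple_graphD[OF H(1) pq] by blast
    then show "q \<in> e" by blast
  qed (use a eV in auto)
  then have "card (vertices H) \<le> 2"
    using eV by (metis card_mono card.infinite zero_neq_numeral)
  then show False using H(3) by simp
qed

lemma rainbow_saturated_card_vertices_le:
  assumes "simple_graph H" "connected_graph H" "card (vertices H) \<ge> 3" "t \<ge> 1"
    and G: "rainbow_saturated t H G c"
  shows "card (vertices G) \<le> 2 * card (edges G) + 1"
proof -
  have sG: "simple_graph G" and fin: "finite (vertices G)"
    using G by (auto simp: rainbow_saturated_def simple_graph_def)
  have fE: "finite (edges G)"
    using sG finite_pairs fin by (auto simp: simple_graph_def intro: finite_subset)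
  have "card (\<Union>(edges G)) \<le> (\<Sum>e\<in>edges G. card e)"
    by (rule card_Union_le_sum_card)
  also have "\<dots> = 2 * card (edges G)"
    using simple_graphD(2)[OF sG] by simp
  finally have 1: "card (\<Union>(edges G)) \<le> 2 * card (edges G)" .
  have 2: "card (vertices G - \<Union>(edges G)) \<le> 1"
    using rainbow_saturated_isolated_unique[OF assms] fin by (simp add: card_le_Suc0_iff_eq)
  have fU: "finite (\<Union>(edges G))"
    using simple_graphD(1)[OF sG] fin by (meson Sup_least finite_subset)
  have "card (vertices G) \<le> card (\<Union>(edges G) \<union> (vertices G - \<Union>(edges G)))"
    using fin fU by (intro card_mono) auto
  also have "\<dots> \<le> card (\<Union>(edges G)) + card (vertices G - \<Union>(edges G))"
    by (rule card_Un_le)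
  finally show ?thesis using 1 2 by simp
qed

text \<open>The \<open>LEAST\<close> is attained because a saturated graph on \<open>n\<close>
  vertices exists, so the bound for saturated graphs applies to a minimiser.\<close>

lemma le_rainbow_sat:
  assumes "simple_graph H" "connected_graph H" "card (vertices H) \<ge> 3" "card (edges H) \<ge> 2" "t \<ge> 1"
  shows "n \<le> 2 * rainbow_sat t n H + 1"
proof -
  let ?P = "\<lambda>m. \<exists>(G :: nat ugraph) c. card (vertices G) = n \<and> rainbow_saturated t H G c \<and> card (edges G) = m"
  have "\<exists>m. ?P m"
    using rainbow_saturated_exists[OF assms(1,4,5)] by blast
  then have "?P (rainbow_sat t n H)"
    unfolding rainbow_sat_def by (rule LeastI_ex)
  then show ?thesis
    using rainbow_saturated_card_vertices_le[OF assms(1-3,5)] by fastforce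
qed

lemma rainbow_sat_bigtheta:
  assumes "simple_graph H" "connected_graph H" "card (vertices H) \<ge> 3" "card (edges H) \<ge> 2" "t \<ge> 1"
    and upper: "\<And>n. n \<ge> n0 \<Longrightarrow> rainbow_sat t n H \<le> C * n"
  shows "(\<lambda>n. real (rainbow_sat t n H)) \<in> \<Theta>(\<lambda>n. real n)"
proof (rule bigthetaI)
  have "real (rainbow_sat t n H) \<le> real C * real n" if "n \<ge> n0" for n
    using of_nat_mono[OF upper[OF that], where 'a = real] by simp
  then show "(\<lambda>n. real (rainbow_sat t n H)) \<in> O(\<lambda>n. real n)"
    by (intro bigoI[of _ "real C"] eventually_sequentiallyI[of n0]) simp
  \<comment> \<open>From \<open>n \<ge> 2\<close> the saturation number is positive, and the
    additive 1 disappears in the factor.\<close>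
  have "real n \<le> 4 * real (rainbow_sat t n H)" if "n \<ge> 2" for n
    using le_rainbow_sat[OF assms(1-5), of n] that by linarith
  then have "(\<lambda>n. real n) \<in> O(\<lambda>n. real (rainbow_sat t n H))"
    by (intro bigoI[of _ 4] eventually_sequentiallyI[of 2]) simp
  then show "(\<lambda>n. real (rainbow_sat t n H)) \<in> \<Omega>(\<lambda>n. real n)"
    by (simp add: bigomega_iff_bigo)
qed

section \<open>Reduction of the upper bound to one gadget of constant size\<close>

section \<open>Disjoint copies of a gadget\<close>

text \<open>Take two disjoint copies of \<open>G\<close>, indexed by \<open>True\<close> and \<open>False\<close>, and join \<open>x\<close> in the
  first copy to \<open>y\<close> in the second one by an edge of colour \<open>k\<close>: the map \<open>\<lambda>a. (s a, h a)\<close>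
  is a rainbow embedding of \<open>H\<close> that sends the edge \<open>{p, q}\<close> of \<open>H\<close> to the new edge.\<close>
definition bridged :: "'a ugraph \<Rightarrow> 'b ugraph \<Rightarrow> ('b set \<Rightarrow> nat) \<Rightarrow> 'b \<Rightarrow> 'b \<Rightarrow> nat \<Rightarrow> bool" where
  "bridged H G c x y k \<longleftrightarrow> (\<exists>(s :: 'a \<Rightarrow> bool) h p q.
     inj_on (\<lambda>a. (s a, h a)) (vertices H) \<and> h ` vertices H \<subseteq> vertices G \<and>
     {p, q} \<in> edges H \<and> s p \<and> \<not> s q \<and> h p = x \<and> h q = y \<and>
     (\<forall>e\<in>edges H - {{p, q}}. (\<exists>b. s ` e \<subseteq> {b}) \<and> h ` e \<in> edges G \<and> c (h ` e) \<noteq> k) \<and>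
     inj_on (\<lambda>e. c (h ` e)) (edges H - {{p, q}}))"

text \<open>\<open>V\<close> need not be a full product: the last copy of the gadget may be
  incomplete, so that every number of vertices can be realised.\<close>

definition copies :: "'b ugraph \<Rightarrow> (nat \<times> 'b) set \<Rightarrow> (nat \<times> 'b) ugraph" where
  "copies G V = \<lparr>vertices = V, edges = {e \<in> pairs V. (\<exists>i. fst ` e \<subseteq> {i}) \<and> snd ` e \<in> edges G}\<rparr>"

text \<open>A copy of the connected graph \<open>H\<close> stays within one index, and forgetting
  the index gives a rainbow copy in \<open>G\<close>.\<close>

lemma no_rainbow_copy_copies:
  assumes H: "simple_graph H" "connected_graph H"
    and G: "\<not> has_rainbow_copy H G c" and V: "snd ` V \<subseteq> vertices G"
  shows "\<not> has_rainbow_copy H (copies G V) (\<lambda>e. c (snd ` e))"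
proof
  assume "has_rainbow_copy H (copies G V) (\<lambda>e. c (snd ` e))"
  then obtain f where f: "rainbow_embedding H (copies G V) (\<lambda>e. c (snd ` e)) f"
    using has_rainbow_copy_iff[OF H(1)] by blast
  have E: "f ` e \<in> pairs V" "\<exists>i. fst ` f ` e \<subseteq> {i}" "snd ` f ` e \<in> edges G" if "e \<in> edges H" for e
    using f that by (auto simp: rainbow_embedding_def copies_def)
  obtain a where a: "a \<in> vertices H"
    using H(2) by (auto simp: connected_graph_def)
  have "vertices H \<subseteq> {b. fst (f b) = fst (f a)}"
  proof (rule connected_graph_closed[OF H(2)])
    fix p q assume "p \<in> {b. fst (f b) = fst (f a)}" "{p, q} \<in> edges H"
    then show "q \<in> {b. fst (f b) = fst (f a)}"
      using E(2)[of "{p, q}"] by auto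
  qed (use a in auto)
  then have "fst (f b) = fst (f a)" if "b \<in> vertices H" for b
    using that by blast
  then have "inj_on (snd \<circ> f) (vertices H)"
    using f by (simp add: rainbow_embedding_def inj_on_def prod_eq_iff)
  moreover have "(snd \<circ> f) ` vertices H \<subseteq> vertices G"
    using f V by (auto simp: rainbow_embedding_def copies_def)
  moreover have "(snd \<circ> f) ` e = snd ` f ` e" for e
    by (simp add: image_comp)
  ultimately have "rainbow_embedding H G c (snd \<circ> f)"
    using f E(3) by (simp add: rainbow_embedding_def)
  then show False
    using G has_rainbow_copy_iff[OF H(1)] by blast
qed

text \<open>The two sides of \<open>bridged\<close> are realised by the copies \<open>i\<close> and
  \<open>j\<close>. Every other edge stays on one side and avoids the colour \<open>k\<close>, hence
  cannot clash with the bridge.\<close>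

lemma has_rainbow_copy_bridge:
  assumes H: "simple_graph H" and G: "simple_graph G" and br: "bridged H G c x y k"
    and ij: "i \<noteq> j" and V: "{i} \<times> vertices G \<subseteq> V" "{j} \<times> vertices G \<subseteq> V"
  defines "e0 \<equiv> {(i, x), (j, y)}"
  shows "has_rainbow_copy H ((copies G V)\<lparr>edges := insert e0 (edges (copies G V))\<rparr>)
           ((\<lambda>e. c (snd ` e))(e0 := k))"
proof -
  obtain s h p q where inj: "inj_on (\<lambda>a. (s a, h a)) (vertices H)"
    and hV: "h ` vertices H \<subseteq> vertices G" and pq: "{p, q} \<in> edges H" "s p" "\<not> s q" "h p = x" "h q = y"
    and rest: "\<forall>e\<in>edges H - {{p, q}}. (\<exists>b. s ` e \<subseteq> {b}) \<and> h ` e \<in> edges G \<and> c (h ` e) \<noteq> k"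
    and inj': "inj_on (\<lambda>e. c (h ` e)) (edges H - {{p, q}})"
    using br unfolding bridged_def by (elim exE conjE) (rule that; assumption)
  define f where "f a = (if s a then i else j, h a)" for a
  have injf: "inj_on f (vertices H)"
    using inj ij by (auto simp: inj_on_def f_def split: if_splits)
  have fV: "f ` vertices H \<subseteq> V"
  proof
    fix v assume "v \<in> f ` vertices H"
    then obtain a where "a \<in> vertices H" "v = f a" by blast
    then show "v \<in> V" using hV V unfolding f_def by (cases "s a") auto
  qed
  have snd_f: "snd ` f ` e = h ` e" for e
    by (simp add: f_def image_image)
  have f_pq: "f ` {p, q} = e0"
    using pq by (auto simp: f_def e0_def)
  have e_fst: "\<exists>b. fst ` f ` e \<subseteq> {b}" if e: "e \<in> edges H - {{p, q}}" for e
  proof -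
    obtain b where b: "s ` e \<subseteq> {b}" using bspec[OF rest e] by (elim conjE exE) (rule that)
    have "fst ` f ` e = (\<lambda>b. if b then i else j) ` s ` e"
      by (simp only: f_def image_image fst_conv)
    also have "\<dots> \<subseteq> (\<lambda>b. if b then i else j) ` {b}"
      using b by (rule image_mono)
    also have "\<dots> = {if b then i else j}" by simp
    finally show ?thesis by (rule exI)
  qed
  have f_ne: "f ` e \<noteq> e0" if e: "e \<in> edges H - {{p, q}}" for e
  proof
    assume "f ` e = e0"
    then obtain b where "fst ` e0 \<subseteq> {b}" using e_fst[OF e] by metis
    then show False using ij by (simp add: e0_def)
  qed
  have f_edge: "f ` e \<in> edges (copies G V)" if e: "e \<in> edges H - {{p, q}}" for e
  proof -
    have "e \<in> pairs (vertices H)" using e H by (auto simp: simple_graph_def)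
    then have "f ` e \<in> pairs (f ` vertices H)" using pairs_image[OF injf] by simp
    then have 1: "f ` e \<in> pairs V" using pairs_mono[OF fV] by blast
    have 2: "snd ` f ` e \<in> edges G"
      unfolding snd_f using bspec[OF rest e] by (elim conjE)
    show ?thesis
      unfolding copies_def ugraph.select_convs
      by (intro CollectI conjI 1 2 e_fst[OF e])
  qed
  have "inj_on (\<lambda>e. ((\<lambda>e. c (snd ` e))(e0 := k)) (f ` e)) (edges H)"
  proof (rule inj_onI)
    fix e1 e2 assume e: "e1 \<in> edges H" "e2 \<in> edges H"
      "((\<lambda>e. c (snd ` e))(e0 := k)) (f ` e1) = ((\<lambda>e. c (snd ` e))(e0 := k)) (f ` e2)"
    show "e1 = e2"
    proof (cases "e1 = {p, q} \<or> e2 = {p, q}")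
      case True
      have other: "((\<lambda>e. c (snd ` e))(e0 := k)) (f ` e) \<noteq> k" if "e \<in> edges H - {{p, q}}" for e
        using f_ne[OF that] bspec[OF rest that] by (simp add: snd_f)
      have "((\<lambda>e. c (snd ` e))(e0 := k)) (f ` {p, q}) = k"
        unfolding f_pq by simp
      then show ?thesis
        using True e other by (metis DiffI singletonD)
    next
      case False
      then have "c (h ` e1) = c (h ` e2)"
        using e f_ne by (simp add: snd_f)
      then show ?thesis
        using inj' e False by (auto simp: inj_on_def)
    qed
  qed
  moreover have "f ` e \<in> insert e0 (edges (copies G V))" if "e \<in> edges H" for e
    using f_edge[of e] f_pq that by (cases "e = {p, q}") auto
  moreover have "vertices (copies G V) = V"
    by (simp add: copies_def)
  ultimately have "rainbow_embedding H ((copies G V)\<lparr>edges := insert e0 (edges (copies G V))\<rparr>)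
           ((\<lambda>e. c (snd ` e))(e0 := k)) f"
    unfolding rainbow_embedding_def using injf fV by simp
  then show ?thesis
    using has_rainbow_copy_iff[OF H] by blast
qed

text \<open>Two vertices in different complete copies can be bridged in every colour; all other
  pairs number O(n). The disjunction in the last hypothesis reflects that an edge has no
  orientation.\<close>

lemma rainbow_sat_le_gadget:
  fixes G :: "'b ugraph"
  assumes H: "simple_graph H" "connected_graph H"
    and G: "simple_graph G" "vertices G \<noteq> {}" "edge_colouring t G c" "\<not> has_rainbow_copy H G c"
    and br: "\<And>x y k. \<lbrakk>x \<in> vertices G; y \<in> vertices G; k \<in> {1..t}\<rbrakk> \<Longrightarrow>
      bridged H G c x y k \<or> bridged H G c y x k"
  shows "rainbow_sat t n H \<le> 2 * card (vertices G) * n"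
proof -
  let ?U = "vertices G"
  have finU: "finite ?U" using G by (simp add: simple_graph_def)
  have "card ?U > 0" using finU G(2) by (simp add: card_gt_0_iff)
  then have "n mod card ?U \<le> card ?U" by (simp add: less_imp_le)
  then obtain L where L: "L \<subseteq> ?U" "card L = n mod card ?U"
    using obtain_subset_with_card_n by blast
  have finL: "finite L" using L finU finite_subset by blast
  define q where "q = n div card ?U"
  \<comment> \<open>There are \<open>q\<close> complete copies, and the remaining
    \<open>n mod card ?U\<close> vertices form a partial copy of index \<open>q\<close>.\<close>
  define V where "V = {..<q} \<times> ?U \<union> {q} \<times> L"
  have finV: "finite V" using finU finL by (simp add: V_def)
  have "card V = card ({..<q} \<times> ?U) + card ({q} \<times> L)"
    unfolding V_def using finU finL by (intro card_Un_disjoint) auto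
  then have cardV: "card V = n"
    using L by (simp add: q_def card_cartesian_product)
  have sndV: "snd ` V \<subseteq> ?U" using L by (auto simp: V_def)
  define B where "B = (\<lambda>(v, p, b). {v, (if b then q else fst v, p)}) ` (V \<times> ?U \<times> (UNIV :: bool set))"
  have finB: "finite B" using finV finU by (simp add: B_def)
  have "card B \<le> card (V \<times> ?U \<times> (UNIV :: bool set))"
    unfolding B_def using finV finU by (intro card_image_le) auto
  then have cardB: "card B \<le> 2 * card ?U * n" by (simp add: cardV card_cartesian_product mult_ac)
  have memB: "{v, w} \<in> B" if "v \<in> V" "w \<in> V" "fst v = fst w \<or> fst w = q" for v w
  proof -
    have "snd w \<in> ?U" using sndV that by auto
    moreover have "{v, w} = (\<lambda>(v, p, b). {v, (if b then q else fst v, p)}) (v, snd w, fst w = q)"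
      using that(3) by (auto simp: prod_eq_iff)
    ultimately show ?thesis unfolding B_def using that(1) by blast
  qed
  have "rainbow_sat t (card (vertices (copies G V))) H \<le> card B"
  proof (rule rainbow_sat_le_card[OF H(1), where c = "\<lambda>e. c (snd ` e)"])
    show "simple_graph (copies G V)"
      using finV by (auto simp: simple_graph_def copies_def)
    show "edge_colouring t (copies G V) (\<lambda>e. c (snd ` e))"
      using G(3) by (auto simp: edge_colouring_def copies_def)
    show "\<not> has_rainbow_copy H (copies G V) (\<lambda>e. c (snd ` e))"
      using no_rainbow_copy_copies[OF H G(4) sndV] .
    show "edges (copies G V) \<subseteq> B"
    proof
      fix e assume "e \<in> edges (copies G V)"
      then have e: "e \<in> pairs V" "\<exists>i. fst ` e \<subseteq> {i}" by (auto simp: copies_def)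
      from e(1) show "e \<in> B"
      proof (rule pairsE)
        fix v w assume "e = {v, w}" "v \<in> V" "w \<in> V"
        then show ?thesis using e(2) memB[of v w] by auto
      qed
    qed
    show "finite B" by (rule finB)
  next
    fix e k assume e: "e \<in> pairs (vertices (copies G V)) - B" and k: "k \<in> {1..t}"
    then have "e \<in> pairs V" by (simp add: copies_def)
    then show "has_rainbow_copy H ((copies G V)\<lparr>edges := insert e (edges (copies G V))\<rparr>)
        ((\<lambda>e. c (snd ` e))(e := k))"
    proof (rule pairsE)
      fix v w assume vw: "e = {v, w}" "v \<in> V" "w \<in> V"
      obtain i x j y where ij: "v = (i, x)" "w = (j, y)" by (metis surj_pair)
      have "{v, w} \<notin> B" "{w, v} \<notin> B"
        using e vw(1) by (simp_all add: insert_commute)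
      then have ne: "i \<noteq> j" "i \<noteq> q" "j \<noteq> q"
        using vw(2,3) ij memB[of v w] memB[of w v] by auto
      have mem: "i < q" "x \<in> ?U" "j < q" "y \<in> ?U" using vw ij ne by (auto simp: V_def)
      then have sub: "{i} \<times> ?U \<subseteq> V" "{j} \<times> ?U \<subseteq> V" by (auto simp: V_def)
      have "bridged H G c x y k \<or> bridged H G c y x k"
        using br k mem by blast
      then show ?thesis
      proof
        assume "bridged H G c x y k"
        from has_rainbow_copy_bridge[OF H(1) G(1) this ne(1) sub] show ?thesis
          by (simp add: vw ij)
      next
        assume "bridged H G c y x k"
        from has_rainbow_copy_bridge[OF H(1) G(1) this ne(1)[symmetric] sub(2,1)] show ?thesis
          by (simp add: vw ij insert_commute)
      qed
    qed
  qed
  then show ?thesis using cardV cardB by (simp add: copies_def)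
qed

section \<open>Bridging rainbow cliques on |H| - 1 vertices\<close>

section \<open>Graphs with a pendant edge\<close>

text \<open>This prescribes where a few vertices of \<open>H\<close> go; the others follow because
  the complements have equal size.\<close>

lemma ex_bij_betw_extending:
  assumes "finite A" "finite B" "card A = card B" "S \<subseteq> A" "inj_on g S" "g ` S \<subseteq> B"
  shows "\<exists>h. bij_betw h A B \<and> (\<forall>a\<in>S. h a = g a)"
proof -
  have "card (A - S) = card (B - g ` S)"
    using assms by (simp add: card_Diff_subset finite_subset card_image)
  then obtain h where h: "bij_betw h (A - S) (B - g ` S)"
    using assms(1,2) finite_same_card_bij[of "A - S" "B - g ` S"] by auto
  let ?h = "\<lambda>a. if a \<in> S then g a else h a"
  have "bij_betw ?h S (g ` S)"
    using assms(5) by (simp add: bij_betw_def inj_on_def)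
  moreover have "bij_betw ?h (A - S) (B - g ` S)"
    using h by (rule bij_betw_cong[THEN iffD1, rotated]) auto
  ultimately have "bij_betw ?h (S \<union> (A - S)) (g ` S \<union> (B - g ` S))"
    by (rule bij_betw_combine) auto
  then show ?thesis
    using assms(4,6) by (intro exI[of _ ?h]) (simp add: Un_absorb1)
qed

lemma card_pairs: "finite V \<Longrightarrow> card (pairs V) = card V choose 2"
  unfolding pairs_def by (rule n_subsets)

lemma ex_bij_colouring:
  assumes "finite V"
  shows "\<exists>c. bij_betw c (pairs V) {1..card V choose 2}"
  using assms by (intro finite_same_card_bij) (auto simp: finite_pairs card_pairs)

lemma pairs_memberE:
  assumes "e \<in> pairs V" "x \<in> e"
  obtains z where "e = {x, z}" "z \<in> V" "z \<noteq> x"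
  using assms by (auto elim!: pairsE)

section \<open>Structure of \<open>H\<close>: a leaf \<open>v\<close>, its neighbour
  \<open>u\<close> and the remaining vertices \<open>K\<close>\<close>

locale pendant_graph =
  fixes H :: "'a ugraph" and u v :: 'a
  assumes H: "simple_graph H" and conn: "connected_graph H"
    and not_conical: "\<not> conical_vertex H u"
    and uv: "{u, v} \<in> edges H" and leaf: "degree H v = 1"
begin

definition K :: "'a set" where
  "K = vertices H - {u, v}"

lemma finite_vertices: "finite (vertices H)"
  using H by (simp add: simple_graph_def)

lemma finite_K: "finite K"
  using finite_vertices by (simp add: K_def)

lemma edge_pairs: "e \<in> edges H \<Longrightarrow> e \<in> pairs (vertices H)"
  using H by (auto simp: simple_graph_def)

lemma uv_vertices: "u \<in> vertices H" "v \<in> vertices H" "u \<noteq> v"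
  using edge_pairs[OF uv] by auto

lemma uv_notin_K: "u \<notin> K" "v \<notin> K"
  by (auto simp: K_def)

lemma vertices_eq: "vertices H = insert u (insert v K)"
  using uv_vertices by (auto simp: K_def)

lemma card_vertices: "card (vertices H) = card K + 2"
  using uv_vertices uv_notin_K finite_K by (simp add: vertices_eq)

lemma edge_leaf: "e \<in> edges H \<Longrightarrow> v \<in> e \<Longrightarrow> e = {u, v}"
proof -
  assume e: "e \<in> edges H" "v \<in> e"
  obtain e' where "{e \<in> edges H. v \<in> e} = {e'}"
    using leaf by (auto simp: degree_def card_1_singleton_iff)
  then have *: "x \<in> edges H \<and> v \<in> x \<longleftrightarrow> x = e'" for x by (simp add: set_eq_iff)
  show ?thesis using *[of e] *[of "{u, v}"] e uv by simp
qed

lemma edge_cases: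
  assumes "e \<in> edges H"
  obtains "e = {u, v}" | b where "e = {u, b}" "b \<in> K" | "e \<in> pairs K"
proof -
  from edge_pairs[OF assms] show thesis
  proof (rule pairsE)
    fix x y assume *: "e = {x, y}" "x \<in> vertices H" "y \<in> vertices H" "x \<noteq> y"
    show thesis
    proof (cases "v \<in> e")
      case True
      then show thesis using edge_leaf[OF assms] that(1) by blast
    next
      case False
      then show thesis
        using * that(2)[of x] that(2)[of y] that(3) by (auto simp: vertices_eq insert_commute)
    qed
  qed
qed

text \<open>Otherwise \<open>u\<close> is adjacent to all of \<open>K\<close> and to
  \<open>v\<close>, that is, conical.\<close>

lemma nonneighbour: "\<exists>b\<in>K. {u, b} \<notin> edges H"
proof (rule ccontr)
  assume "\<not> ?thesis"
  then have all: "{u, b} \<in> edges H" if "b \<in> insert v K" for b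
    using uv that by auto
  have "{e \<in> edges H. u \<in> e} = (\<lambda>b. {u, b}) ` insert v K"
  proof (intro equalityI subsetI)
    fix e assume "e \<in> {e \<in> edges H. u \<in> e}"
    then have "e \<in> edges H" "u \<in> e" by auto
    then show "e \<in> (\<lambda>b. {u, b}) ` insert v K"
      using uv_notin_K by (cases rule: edge_cases) (auto simp: pairs_def)
  qed (use all in auto)
  moreover have "card ((\<lambda>b. {u, b}) ` insert v K) = card (insert v K)"
    by (intro card_image) (auto simp: inj_on_def doubleton_eq_iff)
  ultimately have "degree H u = card (vertices H) - 1"
    using finite_K uv_notin_K by (simp add: degree_def card_vertices)
  then show False
    using not_conical uv_vertices by (simp add: conical_vertex_def)
qed

text \<open>Otherwise no edge leaves \<open>{u, v}\<close>, so \<open>K\<close> is empty by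
  connectedness, against \<open>nonneighbour\<close>.\<close>

lemma neighbour: "\<exists>a\<in>K. {u, a} \<in> edges H"
proof (rule ccontr)
  assume no: "\<not> ?thesis"
  have "vertices H \<subseteq> {u, v}"
  proof (rule connected_graph_closed[OF conn])
    fix x y assume x: "x \<in> {u, v}" and xy: "{x, y} \<in> edges H"
    show "y \<in> {u, v}"
    proof (cases "x = v")
      case True
      then show ?thesis using edge_leaf[OF xy] by auto
    next
      case False
      then have "y \<notin> K" using x xy no by auto
      then show ?thesis using edge_pairs[OF xy] by (auto simp: vertices_eq)
    qed
  qed (use uv_vertices in auto)
  then have "K = {}" by (auto simp: K_def)
  then show False using nonneighbour by simp
qed

lemma card_K: "card K \<ge> 2"
proof -
  obtain a b where "a \<in> K" "{u, a} \<in> edges H" "b \<in> K" "{u, b} \<notin> edges H"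
    using neighbour nonneighbour by blast
  then have "card {a, b} = 2" "{a, b} \<subseteq> K" by (auto simp: card_insert_if)
  then show ?thesis using card_mono[OF finite_K, of "{a, b}"] by simp
qed

lemma card_edges: "card (edges H) \<ge> 2"
proof -
  obtain a where "a \<in> K" "{u, a} \<in> edges H" using neighbour by blast
  moreover from this have "{u, v} \<noteq> {u, a}"
    using uv_notin_K by (auto simp: doubleton_eq_iff)
  ultimately have "card {{u, v}, {u, a}} = 2" "{{u, v}, {u, a}} \<subseteq> edges H"
    using uv by simp_all
  moreover have "finite (edges H)"
    using edge_pairs finite_pairs[OF finite_vertices] by (meson finite_subset subsetI)
  ultimately show ?thesis by (metis card_mono)
qed

text \<open>The bridge plays the pendant edge: \<open>u\<close> sits at \<open>x\<close>,
  \<open>K\<close> fills the rest of \<open>L\<close>, and \<open>v\<close> sits at \<open>y\<close>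
  in the other copy. At most one pair of \<open>L\<close> has colour \<open>k\<close>, and
  \<open>cond\<close> provides a non-edge of \<open>H\<close> to put on it.\<close>

lemma bridged_clique:
  assumes L: "L \<subseteq> vertices G" "pairs L \<subseteq> edges G" "finite L" "card L = card K + 1"
    and c: "inj_on c (pairs L)" and x: "x \<in> L" and y: "y \<in> vertices G"
    and cond: "(\<forall>e\<in>pairs L. c e = k \<longrightarrow> x \<in> e) \<or> \<not> pairs K \<subseteq> edges H"
  shows "bridged H G c x y k"
proof -
  have card: "card (insert u K) = card L"
    using L finite_K uv_notin_K by simp
  have "\<exists>h. bij_betw h (insert u K) L \<and> h u = x \<and>
      (\<forall>e\<in>edges H. e \<subseteq> insert u K \<longrightarrow> c (h ` e) \<noteq> k)"
  proof (cases "\<exists>e0\<in>pairs L. c e0 = k")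
    case False
    obtain h where h: "bij_betw h (insert u K) L" "h u = x"
      using ex_bij_betw_extending[of "insert u K" L "{u}" "\<lambda>_. x"] card finite_K L x by auto
    have "h ` e \<in> pairs L" if "e \<in> edges H" "e \<subseteq> insert u K" for e
    proof -
      have "e \<in> pairs (insert u K)" using that edge_pairs by (auto simp: pairs_def)
      then show ?thesis using pairs_image[of h "insert u K" e] h(1) by (simp add: bij_betw_def)
    qed
    then show ?thesis using h False by blast
  next
    case True
    then obtain e0 where e0: "e0 \<in> pairs L" "c e0 = k" by blast
    \<comment> \<open>The non-edge placed on \<open>e0\<close> is taken at \<open>u\<close> if
      \<open>x\<close> lies on \<open>e0\<close>, and inside \<open>K\<close> otherwise.\<close>
    have "\<exists>h e. bij_betw h (insert u K) L \<and> h u = x \<and> e \<in> pairs (insert u K) \<and> h ` e = e0 \<and> e \<notin> edges H"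
    proof (cases "x \<in> e0")
      case True
      then obtain z where z: "e0 = {x, z}" "z \<in> L" "z \<noteq> x"
        using e0(1) by (blast elim: pairs_memberE)
      obtain b where b: "b \<in> K" "{u, b} \<notin> edges H" using nonneighbour by blast
      have ub: "u \<noteq> b" using b uv_notin_K by blast
      obtain h where "bij_betw h (insert u K) L" "\<forall>a\<in>{u, b}. h a = (if a = u then x else z)"
        using ex_bij_betw_extending[of "insert u K" L "{u, b}" "\<lambda>a. if a = u then x else z"]
          card finite_K L x z b ub by auto
      then show ?thesis
        using b ub z by (intro exI[of _ h] exI[of _ "{u, b}"]) auto
    next
      case False
      then have "\<not> pairs K \<subseteq> edges H" using cond e0 by blast
      then obtain e where "e \<in> pairs K" "e \<notin> edges H" by blast
      then obtain b b' where b: "b \<in> K" "b' \<in> K" "b \<noteq> b'" "{b, b'} \<notin> edges H"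
        by (metis pairsE)
      obtain z z' where z: "e0 = {z, z'}" "z \<in> L" "z' \<in> L" "z \<noteq> z'"
        using e0(1) by (rule pairsE)
      have ne: "u \<noteq> b" "u \<noteq> b'" using b uv_notin_K by auto
      let ?g = "\<lambda>a. if a = u then x else if a = b then z else z'"
      have "inj_on ?g {u, b, b'}"
        using z False by (auto simp: inj_on_def)
      moreover have "?g ` {u, b, b'} \<subseteq> L" using z x by auto
      moreover have "{u, b, b'} \<subseteq> insert u K" using b by auto
      ultimately obtain h where "bij_betw h (insert u K) L" "\<forall>a\<in>{u, b, b'}. h a = ?g a"
        using ex_bij_betw_extending[of "insert u K" L "{u, b, b'}" ?g] card finite_K L by auto
      then show ?thesis
        using b ne z by (intro exI[of _ h] exI[of _ "{b, b'}"]) auto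
    qed
    then obtain h e1 where h: "bij_betw h (insert u K) L" "h u = x"
      and e1: "e1 \<in> pairs (insert u K)" "h ` e1 = e0" "e1 \<notin> edges H" by blast
    have "c (h ` e) \<noteq> k" if e: "e \<in> edges H" "e \<subseteq> insert u K" for e
    proof
      assume k: "c (h ` e) = k"
      have e': "e \<in> pairs (insert u K)" using e edge_pairs by (auto simp: pairs_def)
      then have "h ` e \<in> pairs L" using pairs_image[of h "insert u K" e] h(1) by (simp add: bij_betw_def)
      then have "h ` e = h ` e1" using c e0 e1(2) k by (auto dest: inj_onD)
      then have "e = e1"
        using inj_on_image_pairs[of h "insert u K"] h(1) e' e1(1) by (auto simp: bij_betw_def dest: inj_onD)
      then show False using e e1 by simp
    qed
    then show ?thesis using h by blast
  qed
  then obtain h where h: "bij_betw h (insert u K) L" "h u = x"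
    and hk: "\<And>e. e \<in> edges H \<Longrightarrow> e \<subseteq> insert u K \<Longrightarrow> c (h ` e) \<noteq> k" by blast
  have inj: "inj_on h (insert u K)" and im: "h ` insert u K = L"
    using h(1) by (auto simp: bij_betw_def)
  \<comment> \<open>\<open>y\<close> may also be a vertex of \<open>L\<close>; the leaf is kept
    apart by its side, which is why injectivity is claimed for the pair
    \<open>(a \<noteq> v, ?h a)\<close>.\<close>
  let ?h = "h(v := y)"
  have sub: "e \<in> pairs (insert u K)" "v \<notin> e" if "e \<in> edges H - {{u, v}}" for e
  proof -
    show "v \<notin> e" using that edge_leaf by blast
    then show "e \<in> pairs (insert u K)"
      using edge_pairs[of e] that by (auto simp: pairs_def vertices_eq)
  qed
  have img: "?h ` e = h ` e" if "e \<in> edges H - {{u, v}}" for e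
    using sub(2)[OF that] by (intro image_cong) auto
  have hL: "h ` e \<in> pairs L" if "e \<in> edges H - {{u, v}}" for e
    using pairs_image[OF inj sub(1)[OF that]] im by simp
  show ?thesis
    unfolding bridged_def
  proof (intro exI conjI)
    show "inj_on (\<lambda>a. (a \<noteq> v, ?h a)) (vertices H)"
      using inj by (auto simp: vertices_eq inj_on_def)
    show "?h ` vertices H \<subseteq> vertices G"
      using im L(1) y by (auto simp: vertices_eq)
    show "{u, v} \<in> edges H" by (rule uv)
    show "u \<noteq> v" "\<not> v \<noteq> v" "?h u = x" "?h v = y"
      using uv_vertices h by auto
    show "\<forall>e\<in>edges H - {{u, v}}. (\<exists>b. (\<lambda>a. a \<noteq> v) ` e \<subseteq> {b}) \<and> ?h ` e \<in> edges G \<and> c (?h ` e) \<noteq> k"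
    proof (intro ballI conjI)
      fix e assume e: "e \<in> edges H - {{u, v}}"
      show "\<exists>b. (\<lambda>a. a \<noteq> v) ` e \<subseteq> {b}"
        using sub(2)[OF e] by (intro exI[of _ True]) auto
      show "?h ` e \<in> edges G"
        unfolding img[OF e] using hL[OF e] L(2) by blast
      show "c (?h ` e) \<noteq> k"
        unfolding img[OF e] using hk[of e] e sub[OF e] by (auto simp: pairs_def)
    qed
    show "inj_on (\<lambda>e. c (?h ` e)) (edges H - {{u, v}})"
    proof (rule inj_onI)
      fix e e' assume e: "e \<in> edges H - {{u, v}}" "e' \<in> edges H - {{u, v}}" "c (?h ` e) = c (?h ` e')"
      have "c (h ` e) = c (h ` e')"
        using e(3) unfolding img[OF e(1)] img[OF e(2)] .
      then have "h ` e = h ` e'"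
        using inj_onD[OF c _ hL hL] e by blast
      then show "e = e'"
        using inj_onD[OF inj_on_image_pairs[OF inj] _ sub(1) sub(1)] e by blast
    qed
  qed
qed

text \<open>Here the bridge plays the edge from \<open>u\<close> to its only neighbour
  \<open>a\<close> in \<open>K\<close>: \<open>K\<close> lies in one copy, and \<open>u\<close>,
  \<open>v\<close> lie in the other. \<open>K\<close> avoids the end \<open>p\<close> of
  \<open>e0\<close>, and the image of \<open>uv\<close> contains \<open>y\<close>, which is not on
  \<open>e0\<close>, so colour \<open>k\<close> is free for the bridge.\<close>

lemma bridged_degree_two:
  assumes G: "pairs (vertices G) \<subseteq> edges G" "finite (vertices G)" "card (vertices G) = card K + 1"
    and c: "inj_on c (pairs (vertices G))" and x: "x \<in> vertices G" and y: "y \<in> vertices G"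
    and a: "a \<in> K" "\<And>b. b \<in> K \<Longrightarrow> {u, b} \<in> edges H \<longleftrightarrow> b = a"
    and e0: "e0 \<in> pairs (vertices G)" "c e0 = k" "x \<notin> e0" "y \<notin> e0"
  shows "bridged H G c x y k"
proof -
  obtain p p' where p: "e0 = {p, p'}" "p \<in> vertices G" "p' \<in> vertices G" "p \<noteq> p'"
    using e0(1) by (rule pairsE)
  have px: "p \<noteq> x" "p \<noteq> y" using p e0 by auto
  \<comment> \<open>Exactly |K| vertices are left for \<open>K\<close>; in the other copy
    \<open>p\<close> hosts the leaf.\<close>
  let ?L = "vertices G - {p}"
  have card: "card K = card ?L" using G p by simp
  obtain h where h: "bij_betw h K ?L" "h a = x"
    using ex_bij_betw_extending[of K ?L "{a}" "\<lambda>_. x"] card finite_K G a(1) x px by auto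
  have inj: "inj_on h K" and im: "h ` K = ?L"
    using h(1) by (auto simp: bij_betw_def)
  let ?h = "h(u := y, v := p)"
  have hK: "?h ` e = h ` e" if "e \<in> pairs K" for e
    using that uv_notin_K by (intro image_cong) (auto simp: pairs_def)
  have huv: "?h ` {u, v} = {y, p}" using uv_vertices by auto
  have hL: "h ` e \<in> pairs ?L" if "e \<in> pairs K" for e
    using pairs_image[OF inj that] im by simp
  have cases: "e = {u, v} \<or> e \<in> pairs K" if "e \<in> edges H - {{a, u}}" for e
  proof -
    have "e \<in> edges H" using that by simp
    then show ?thesis
    proof (cases rule: edge_cases)
      case (2 b)
      then show ?thesis using that a(2)[of b] by (simp add: insert_commute)
    qed auto
  qed
  have sub: "pairs ?L \<subseteq> pairs (vertices G)" by (rule pairs_mono) auto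
  have p_notin: "p \<notin> h ` e" if "e \<in> pairs K" for e
    using hL[OF that] by (auto simp: pairs_def)
  have img: "?h ` e \<in> pairs (vertices G)" "?h ` e \<noteq> e0" if "e \<in> edges H - {{a, u}}" for e
  proof -
    show "?h ` e \<in> pairs (vertices G)"
      using cases[OF that]
    proof
      assume "e = {u, v}"
      then show ?thesis unfolding huv[folded \<open>e = {u, v}\<close>] using p y px by simp
    next
      assume e: "e \<in> pairs K"
      show ?thesis unfolding hK[OF e] using hL[OF e] sub by blast
    qed
    show "?h ` e \<noteq> e0"
      using cases[OF that]
    proof
      assume "e = {u, v}"
      then show ?thesis unfolding huv[folded \<open>e = {u, v}\<close>] using e0(4) by blast
    next
      assume e: "e \<in> pairs K"
      show ?thesis unfolding hK[OF e] using p_notin[OF e] p(1) by blast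
    qed
  qed
  show ?thesis
    unfolding bridged_def
  proof (intro exI conjI)
    show "inj_on (\<lambda>a. (a \<in> K, ?h a)) (vertices H)"
      using inj uv_notin_K px by (auto simp: vertices_eq inj_on_def)
    show "?h ` vertices H \<subseteq> vertices G"
      using im y p by (auto simp: vertices_eq)
    show "{a, u} \<in> edges H" using a by (simp add: insert_commute)
    show "a \<in> K" "u \<notin> K" "?h a = x" "?h u = y"
      using a uv_vertices uv_notin_K h by auto
    show "\<forall>e\<in>edges H - {{a, u}}. (\<exists>b. (\<lambda>a. a \<in> K) ` e \<subseteq> {b}) \<and> ?h ` e \<in> edges G \<and> c (?h ` e) \<noteq> k"
    proof (intro ballI conjI)
      fix e assume e: "e \<in> edges H - {{a, u}}"
      show "\<exists>b. (\<lambda>a. a \<in> K) ` e \<subseteq> {b}"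
        using cases[OF e]
      proof
        assume "e = {u, v}"
        then show ?thesis using uv_notin_K by (intro exI[of _ False]) auto
      next
        assume "e \<in> pairs K"
        then show ?thesis by (intro exI[of _ True]) (auto simp: pairs_def)
      qed
      show "?h ` e \<in> edges G" using img(1)[OF e] G(1) by blast
      show "c (?h ` e) \<noteq> k"
        using img[OF e] e0(1,2) c by (auto dest: inj_onD)
    qed
    show "inj_on (\<lambda>e. c (?h ` e)) (edges H - {{a, u}})"
    proof (rule inj_onI)
      fix e e' assume e: "e \<in> edges H - {{a, u}}" "e' \<in> edges H - {{a, u}}" "c (?h ` e) = c (?h ` e')"
      have eq: "?h ` e = ?h ` e'"
        using inj_onD[OF c e(3)] img(1) e by blast
      show "e = e'"
      proof (cases "e = {u, v} \<or> e' = {u, v}")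
        case True
        \<comment> \<open>Only the image of the pendant edge contains \<open>p\<close>.\<close>
        then have "p \<in> ?h ` e" "p \<in> ?h ` e'" using eq huv by auto
        then have "e \<notin> pairs K" "e' \<notin> pairs K" using hK p_notin by metis+
        then show ?thesis using cases e by blast
      next
        case False
        then have *: "e \<in> pairs K" "e' \<in> pairs K" using cases e by blast+
        then have "h ` e = h ` e'" using eq hK by metis
        then show ?thesis using inj_onD[OF inj_on_image_pairs[OF inj]] * by blast
      qed
    qed
  qed
qed

lemma no_rainbow_copy_small:
  assumes "finite (vertices G)" "card (vertices G) < card (vertices H)"
  shows "\<not> has_rainbow_copy H G c"
proof
  assume "has_rainbow_copy H G c"
  then obtain f where "inj_on f (vertices H)" "f ` vertices H \<subseteq> vertices G"
    unfolding has_rainbow_copy_iff[OF H] rainbow_embedding_def by blast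
  then show False using card_inj_on_le assms by (metis not_less)
qed

text \<open>The gadget is a rainbow clique with one vertex too few to contain
  \<open>H\<close>.\<close>

lemma rainbow_sat_le_clique_gadget:
  assumes t: "t \<ge> (card (vertices H))\<^sup>2"
    and cond: "\<not> pairs K \<subseteq> edges H \<or> (\<exists>a\<in>K. \<forall>b\<in>K. {u, b} \<in> edges H \<longleftrightarrow> b = a)"
  shows "rainbow_sat t n H \<le> 2 * (card K + 1) * n"
proof -
  let ?U = "{..card K}"
  obtain c where c: "bij_betw c (pairs ?U) {1..card ?U choose 2}"
    using ex_bij_colouring[of ?U] by auto
  let ?G = "\<lparr>vertices = ?U, edges = pairs ?U\<rparr>"
  have "card ?U choose 2 \<le> card ?U * card ?U"
    by (simp add: choose_two mult_mono div_le_dividend order_trans[OF div_le_dividend])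
  also have "\<dots> \<le> (card (vertices H))\<^sup>2"
    by (simp add: card_vertices power2_eq_square mult_mono)
  finally have ct: "c ` pairs ?U \<subseteq> {1..t}"
    using c t by (auto simp: bij_betw_def)
  have inj: "inj_on c (pairs ?U)" using c by (simp add: bij_betw_def)
  have "rainbow_sat t n H \<le> 2 * card (vertices ?G) * n"
  proof (rule rainbow_sat_le_gadget[OF H conn])
    show "simple_graph ?G" by (simp add: simple_graph_def)
    show "vertices ?G \<noteq> {}" by auto
    show "edge_colouring t ?G c" using ct by (auto simp: edge_colouring_def)
    show "\<not> has_rainbow_copy H ?G c"
      by (rule no_rainbow_copy_small) (simp_all add: card_vertices)
    fix x y k assume xy: "x \<in> vertices ?G" "y \<in> vertices ?G"
    note clique = bridged_clique[of ?U ?G c _ _ k, simplified, OF inj]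
    show "bridged H ?G c x y k \<or> bridged H ?G c y x k"
    proof (cases "(\<forall>e\<in>pairs ?U. c e = k \<longrightarrow> x \<in> e) \<or> (\<forall>e\<in>pairs ?U. c e = k \<longrightarrow> y \<in> e) \<or> \<not> pairs K \<subseteq> edges H")
      case True
      then show ?thesis using clique xy by auto
    next
      case False
      then obtain a where a: "a \<in> K" "\<forall>b\<in>K. {u, b} \<in> edges H \<longleftrightarrow> b = a"
        using cond by blast
      obtain e0 e1 where e: "e0 \<in> pairs ?U" "c e0 = k" "x \<notin> e0" "e1 \<in> pairs ?U" "c e1 = k" "y \<notin> e1"
        using False by blast
      \<comment> \<open>Colour \<open>k\<close> occurs only once, so one pair misses both
        \<open>x\<close> and \<open>y\<close>.\<close>
      then have "e1 = e0" using inj by (auto dest: inj_onD)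
      then have "bridged H ?G c x y k"
        using bridged_degree_two[of ?G c x y a e0 k] inj a e xy by simp
      then show ?thesis ..
    qed
  qed
  then show ?thesis by simp
qed

end

section \<open>Round-robin one-factorisations and their rotations\<close>

section \<open>Rotating a one-factorisation of an even clique\<close>

lemma add_mod_cancel_left_nat:
  fixes a x y n :: nat
  assumes "(a + x) mod n = (a + y) mod n" "x < n" "y < n"
  shows "x = y"
proof -
  have "x = y" if "x \<le> y" "(a + x) mod n = (a + y) mod n" "y < n" for x y
  proof -
    have "n dvd (a + y) - (a + x)"
      using that by (metis add_left_mono mod_eq_dvd_iff_nat)
    then show ?thesis using that by (auto dest: dvd_imp_le)
  qed
  then show ?thesis using assms by (metis nat_le_linear)
qed

lemma double_mod_cancel_nat:
  fixes x y n :: nat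
  assumes "(2 * x) mod n = (2 * y) mod n" "odd n" "x < n" "y < n"
  shows "x = y"
proof -
  have "x = y" if "x \<le> y" "(2 * x) mod n = (2 * y) mod n" "y < n" for x y
  proof -
    have "n dvd 2 * y - 2 * x"
      using that by (metis mod_eq_dvd_iff_nat mult_le_mono2)
    then have "n dvd 2 * (y - x)" by (simp add: diff_mult_distrib2)
    then have "n dvd y - x"
      using \<open>odd n\<close> by (simp add: coprime_dvd_mult_right_iff)
    then show ?thesis using that by (auto dest: dvd_imp_le)
  qed
  then show ?thesis using assms by (metis nat_le_linear)
qed

text \<open>The round-robin schedule: \<open>r - 1\<close> is the point at infinity, the other
  points are residues modulo the odd number \<open>r - 1\<close>. The pair of \<open>i\<close> and
  infinity gets the colour \<open>2 i\<close> that \<open>i\<close> would have with itself.\<close>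

lemma ex_proper_edge_colouring:
  assumes "even r" "r \<ge> 2"
  shows "\<exists>s :: nat set \<Rightarrow> nat. (\<forall>e. s e < r - 1) \<and>
    (\<forall>i<r. \<forall>j<r. \<forall>j'<r. i \<noteq> j \<longrightarrow> i \<noteq> j' \<longrightarrow> s {i, j} = s {i, j'} \<longrightarrow> j = j')"
proof -
  let ?n = "r - 1"
  have odd: "odd ?n" and n: "?n > 0" using assms by auto
  \<comment> \<open>The ends of a pair are distinct, so the sum over the set is the sum of its two
    ends.\<close>
  define s where "s e = (if ?n \<in> e then 2 * \<Sum>(e - {?n}) else \<Sum>e) mod ?n" for e :: "nat set"
  have s1: "s {i, j} = (i + j) mod ?n" if "i < ?n" "j < ?n" "i \<noteq> j" for i j
    using that by (simp add: s_def)
  have s2: "s {i, ?n} = (2 * i) mod ?n" "s {?n, i} = (2 * i) mod ?n" if "i < ?n" for i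
  proof -
    have *: "{i, ?n} - {?n} = {i}" using that by auto
    show "s {i, ?n} = (2 * i) mod ?n" unfolding s_def * by simp
    then show "s {?n, i} = (2 * i) mod ?n" by (simp add: insert_commute)
  qed
  have "j = j'" if A: "i < r" "j < r" "j' < r" "i \<noteq> j" "i \<noteq> j'" "s {i, j} = s {i, j'}" for i j j'
  proof -
    have lt: "x < ?n \<or> x = ?n" if "x < r" for x using that by auto
    consider "i = ?n" | "i < ?n" "j = ?n" "j' = ?n" | "i < ?n" "j < ?n" "j' < ?n"
      | "i < ?n" "j = ?n" "j' < ?n" | "i < ?n" "j < ?n" "j' = ?n"
      using lt[OF A(1)] lt[OF A(2)] lt[OF A(3)] by blast
    then show ?thesis
    proof cases
      case 1
      then have "j < ?n" "j' < ?n" using A lt by auto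
      then show ?thesis using double_mod_cancel_nat[OF _ odd] A(6) s2(2) 1 by metis
    next
      case 3
      then show ?thesis using add_mod_cancel_left_nat[of i j ?n j'] A s1 by metis
    next
      case 4
      \<comment> \<open>Equal colours at infinity and at \<open>j'\<close> would force
        \<open>j' = i\<close>.\<close>
      then have "(i + i) mod ?n = (i + j') mod ?n"
        using A(5,6) s1[of i j'] s2(1)[of i] by (simp add: mult_2)
      then show ?thesis using add_mod_cancel_left_nat[of i i ?n j'] 4 A by blast
    next
      case 5
      then have "(i + i) mod ?n = (i + j) mod ?n"
        using A(4,6) s1[of i j] s2(1)[of i] by (simp add: mult_2)
      then show ?thesis using add_mod_cancel_left_nat[of i i ?n j] 5 A by blast
    qed simp
  qed
  moreover have "s e < ?n" for e using n by (simp add: s_def)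
  ultimately show ?thesis by (intro exI[of _ s]) blast
qed

text \<open>A vertex has \<open>r - 1\<close> edges of different colours, so it sees each of the
  \<open>r - 1\<close> colours. Each colour class is thus a perfect matching, whose members
  \<open>idx\<close> numbers.\<close>

lemma ex_one_factorisation:
  assumes "even r" "r \<ge> 2"
  shows "\<exists>(s :: nat set \<Rightarrow> nat) idx. (\<forall>e. s e < r - 1) \<and>
    (\<forall>e\<in>pairs {..<r}. \<forall>e'\<in>pairs {..<r}. s e = s e' \<longrightarrow> e \<inter> e' \<noteq> {} \<longrightarrow> e = e') \<and>
    (\<forall>i<r. \<forall>m<r - 1. \<exists>e\<in>pairs {..<r}. i \<in> e \<and> s e = m) \<and>
    (\<forall>m<r - 1. bij_betw idx {e \<in> pairs {..<r}. s e = m} {..<r div 2})"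
proof -
  obtain s :: "nat set \<Rightarrow> nat" where s: "\<And>e. s e < r - 1"
    and proper: "\<And>i j j'. \<lbrakk>i < r; j < r; j' < r; i \<noteq> j; i \<noteq> j'; s {i, j} = s {i, j'}\<rbrakk> \<Longrightarrow> j = j'"
    using ex_proper_edge_colouring[OF assms] by blast
  have meet: "e = e'" if e: "e \<in> pairs {..<r}" "e' \<in> pairs {..<r}" "s e = s e'" "i \<in> e" "i \<in> e'" for e e' i
  proof -
    obtain j where j: "e = {i, j}" "j \<in> {..<r}" "j \<noteq> i" using e(1,4) by (rule pairs_memberE)
    obtain j' where j': "e' = {i, j'}" "j' \<in> {..<r}" "j' \<noteq> i" using e(2,5) by (rule pairs_memberE)
    have "i < r" using e(1,4) by (auto simp: pairs_def)
    then have "j = j'" using proper[of i j j'] j j' e(3) by auto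
    then show ?thesis using j j' by simp
  qed
  have cover: "\<exists>e\<in>pairs {..<r}. i \<in> e \<and> s e = m" if i: "i < r" and m: "m < r - 1" for i m
  proof -
    have "inj_on (\<lambda>j. s {i, j}) ({..<r} - {i})"
      using proper i by (auto simp: inj_on_def)
    then have "card ((\<lambda>j. s {i, j}) ` ({..<r} - {i})) = r - 1"
      using i by (simp add: card_image)
    moreover have "(\<lambda>j. s {i, j}) ` ({..<r} - {i}) \<subseteq> {..<r - 1}" using s by auto
    ultimately have "(\<lambda>j. s {i, j}) ` ({..<r} - {i}) = {..<r - 1}"
      by (intro card_subset_eq) auto
    then obtain j where "j \<in> {..<r} - {i}" "s {i, j} = m" using m by (metis (no_types, lifting) imageE lessThan_iff)
    then show ?thesis using i by (intro bexI[of _ "{i, j}"]) auto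
  qed
  let ?M = "\<lambda>m. {e \<in> pairs {..<r}. s e = m}"
  have "\<exists>b. bij_betw b (?M m) {..<r div 2}" if m: "m < r - 1" for m
  proof -
    \<comment> \<open>The disjoint pairs of one class cover all points, so there are
      \<open>r div 2\<close> of them.\<close>
    have "\<Union>(?M m) = {..<r}"
      using cover[OF _ m] by (auto simp: pairs_def)
    moreover have "card (\<Union>(?M m)) = sum card (?M m)"
    proof (rule card_Union_disjoint)
      show "pairwise disjnt (?M m)"
        using meet by (fastforce simp: pairwise_def disjnt_def)
    qed (auto simp: pairs_def intro: finite_subset)
    moreover have "sum card (?M m) = 2 * card (?M m)"
      by (simp add: pairs_def)
    ultimately have "card (?M m) = r div 2" by simp
    then show ?thesis
      by (intro finite_same_card_bij) (auto simp: finite_pairs)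
  qed
  then obtain b where b: "\<And>m. m < r - 1 \<Longrightarrow> bij_betw (b m) (?M m) {..<r div 2}" by metis
  have "bij_betw (\<lambda>e. b (s e) e) (?M m) {..<r div 2}" if "m < r - 1" for m
    using b[OF that] by (rule bij_betw_cong[THEN iffD1, rotated]) auto
  moreover have "e = e'" if "e \<in> pairs {..<r}" "e' \<in> pairs {..<r}" "s e = s e'" "e \<inter> e' \<noteq> {}" for e e'
  proof -
    from that(4) obtain i where i: "i \<in> e" "i \<in> e'" by blast
    show ?thesis using meet[OF that(1-3) i] .
  qed
  ultimately show ?thesis
    using s cover by (intro exI[of _ s] exI[of _ "\<lambda>e. b (s e) e"] conjI) simp_all
qed

text \<open>The pairs that receive a given colour under \<open>\<phi> 0, \<phi> 1, \<dots>\<close> run through a perfect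
  matching of the clique.\<close>
lemma ex_rotating_colourings:
  assumes "even r" "r \<ge> 2"
  shows "\<exists>\<phi> :: nat \<Rightarrow> nat set \<Rightarrow> nat.
    (\<forall>a e. \<phi> a e \<in> {1..r\<^sup>2}) \<and> (\<forall>a. inj_on (\<phi> a) (pairs {..<r})) \<and>
    (\<forall>a<r div 2. \<forall>b<r div 2. \<forall>e\<in>pairs {..<r}. \<forall>i\<in>e. a \<noteq> b \<longrightarrow>
      (\<exists>e'\<in>pairs {..<r}. i \<notin> e' \<and> \<phi> a e' = \<phi> b e)) \<and>
    (\<forall>k. \<forall>i<r. \<exists>a<r div 2. \<forall>e\<in>pairs {..<r}. \<phi> a e = k \<longrightarrow> i \<in> e)"
proof -
  let ?h = "r div 2"
  have h: "?h > 0" using assms by auto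
  obtain s :: "nat set \<Rightarrow> nat" and idx where s': "\<forall>e. s e < r - 1"
    and meet': "\<forall>e\<in>pairs {..<r}. \<forall>e'\<in>pairs {..<r}. s e = s e' \<longrightarrow> e \<inter> e' \<noteq> {} \<longrightarrow> e = e'"
    and cover: "\<forall>i<r. \<forall>m<r - 1. \<exists>e\<in>pairs {..<r}. i \<in> e \<and> s e = m"
    and idx': "\<forall>m<r - 1. bij_betw idx {e \<in> pairs {..<r}. s e = m} {..<?h}"
    using ex_one_factorisation[OF assms] by (elim exE conjE) (rule that; assumption)
  have s: "s e < r - 1" for e using s' by blast
  have meet: "e = e'" if "e \<in> pairs {..<r}" "e' \<in> pairs {..<r}" "s e = s e'" "e \<inter> e' \<noteq> {}" for e e'
    using meet' that by blast
  have idx: "bij_betw idx {e' \<in> pairs {..<r}. s e' = s e} {..<?h}" for e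
    using idx' s by blast
  \<comment> \<open>Each matching owns a block of \<open>r div 2\<close> colours, and
    \<open>a\<close> rotates the colours within the block; the leading 1 makes colours start at
    1.\<close>
  define \<phi> where "\<phi> a e = 1 + (s e * ?h + (a + idx e) mod ?h)" for a e
  have idx_less: "idx e < ?h" if "e \<in> pairs {..<r}" for e
    using idx[of e] that by (auto simp: bij_betw_def)
  have idx_inj: "e = e'" if "e \<in> pairs {..<r}" "e' \<in> pairs {..<r}" "s e = s e'" "idx e = idx e'" for e e'
    using idx[of e] that by (auto simp: bij_betw_def inj_on_def)
  have idx_surj: "\<exists>e'\<in>pairs {..<r}. s e' = s e \<and> idx e' = x" if "x < ?h" for e x
  proof -
    have "x \<in> idx ` {e' \<in> pairs {..<r}. s e' = s e}"
      using idx[of e] that by (simp add: bij_betw_def)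
    then show ?thesis by auto
  qed
  have \<phi>_eq: "\<phi> a e = \<phi> b e' \<longleftrightarrow> s e = s e' \<and> (a + idx e) mod ?h = (b + idx e') mod ?h" for a b e e'
  proof
    assume eq: "\<phi> a e = \<phi> b e'"
    then have "(s e * ?h + (a + idx e) mod ?h) div ?h = (s e' * ?h + (b + idx e') mod ?h) div ?h"
      by (simp add: \<phi>_def)
    then have "s e = s e'" using h by simp
    then show "s e = s e' \<and> (a + idx e) mod ?h = (b + idx e') mod ?h"
      using eq by (simp add: \<phi>_def)
  qed (simp add: \<phi>_def)
  have inj: "inj_on (\<phi> a) (pairs {..<r})" for a
  proof (rule inj_onI)
    fix e e' assume e: "e \<in> pairs {..<r}" "e' \<in> pairs {..<r}" "\<phi> a e = \<phi> a e'"
    then have "s e = s e'" "(a + idx e) mod ?h = (a + idx e') mod ?h"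
      unfolding \<phi>_eq by blast+
    then show "e = e'"
      using e(1,2) idx_inj idx_less add_mod_cancel_left_nat by metis
  qed
  \<comment> \<open>Adding \<open>?h - a\<close> is subtraction of \<open>a\<close> modulo
    \<open>?h\<close>, free of truncation.\<close>
  have shift: "((x + (?h - a)) mod ?h + a) mod ?h = x mod ?h" if "a < ?h" for x a
  proof -
    have "((x + (?h - a)) mod ?h + a) mod ?h = (x + (?h - a) + a) mod ?h"
      by (simp add: mod_add_left_eq)
    also have "x + (?h - a) + a = x + ?h" using that by simp
    finally show ?thesis by simp
  qed
  have range: "\<phi> a e \<in> {1..r\<^sup>2}" for a e
  proof -
    have "\<phi> a e \<le> s e * ?h + ?h" using h by (simp add: \<phi>_def Suc_leI)
    also have "\<dots> = (s e + 1) * ?h" by simp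
    also have "\<dots> \<le> r * r" using s[of e] by (intro mult_le_mono) auto
    finally show ?thesis by (simp add: \<phi>_def power2_eq_square)
  qed
  have other: "\<exists>e'\<in>pairs {..<r}. i \<notin> e' \<and> \<phi> a e' = \<phi> b e"
    if "a < ?h" "b < ?h" "a \<noteq> b" "e \<in> pairs {..<r}" "i \<in> e" for a b e i
  proof -
    \<comment> \<open>The pair of the same matching whose index is shifted by \<open>b - a\<close>.
      It differs from \<open>e\<close> because \<open>a \<noteq> b\<close>, so it is disjoint from
      \<open>e\<close> and misses \<open>i\<close>.\<close>
    let ?x = "(b + idx e + (?h - a)) mod ?h"
    obtain e' where e': "e' \<in> pairs {..<r}" "s e' = s e" "idx e' = ?x"
      using idx_surj[of ?x] h by auto
    have eq: "\<phi> a e' = \<phi> b e"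
      using e' shift[OF that(1), of "b + idx e"] by (simp add: \<phi>_eq add.commute[of a])
    have "e' \<noteq> e"
    proof
      assume "e' = e"
      then have "(idx e + a) mod ?h = (idx e + b) mod ?h"
        using eq by (simp add: \<phi>_eq add.commute)
      then show False using add_mod_cancel_left_nat that(1-3) by blast
    qed
    then have "i \<notin> e'" using meet[OF e'(1) that(4) e'(2)] that(5) by blast
    then show ?thesis using e' eq by blast
  qed
  have avoid: "\<exists>a<?h. \<forall>e\<in>pairs {..<r}. \<phi> a e = k \<longrightarrow> i \<in> e" if i: "i < r" for k i
  proof (cases "\<exists>b e0. e0 \<in> pairs {..<r} \<and> \<phi> b e0 = k")
    case True
    then obtain b e0 where e0: "e0 \<in> pairs {..<r}" "\<phi> b e0 = k" by blast
    obtain e1 where e1: "e1 \<in> pairs {..<r}" "i \<in> e1" "s e1 = s e0"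
      using cover i s[of e0] by blast
    \<comment> \<open>The rotation that moves colour \<open>k\<close> to the pair \<open>e1\<close>
      covering \<open>i\<close> in its matching; by injectivity no other pair has that
      colour.\<close>
    let ?a = "(b + idx e0 + (?h - idx e1)) mod ?h"
    have "\<phi> ?a e1 = k"
      using e0(2) e1 shift[OF idx_less[OF e1(1)], of "b + idx e0"] by (auto simp: \<phi>_eq)
    then have "\<forall>e\<in>pairs {..<r}. \<phi> ?a e = k \<longrightarrow> i \<in> e"
      using inj[of ?a] e1 by (auto dest: inj_onD)
    then show ?thesis using h by (intro exI[of _ ?a]) simp
  next
    case False
    then show ?thesis using h by blast
  qed
  show ?thesis
    by (intro exI[of _ \<phi>] conjI allI impI ballI range inj other avoid) assumption+
qed

section \<open>Hamming graphs as gadgets for \<open>K_r\<close> with a rotated edge, r even\<close>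

section \<open>Cliques of even order with a rotated edge\<close>

definition cube :: "nat \<Rightarrow> nat \<Rightarrow> (nat \<Rightarrow> nat) set" where
  "cube h r = (\<Pi>\<^sub>E a\<in>{..<h}. {..<r})"

definition line :: "nat \<Rightarrow> nat \<Rightarrow> (nat \<Rightarrow> nat) \<Rightarrow> nat \<Rightarrow> (nat \<Rightarrow> nat) set" where
  "line h r p a = {q \<in> cube h r. \<forall>b. b \<noteq> a \<longrightarrow> q b = p b}"

definition hamming :: "nat \<Rightarrow> nat \<Rightarrow> (nat \<Rightarrow> nat) ugraph" where
  "hamming h r = \<lparr>vertices = cube h r, edges = {e \<in> pairs (cube h r). \<exists>a<h. \<exists>p\<in>e. e \<subseteq> line h r p a}\<rparr>"

text \<open>This identifies every line in every direction with \<open>{..<r}\<close>, giving a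
  vertex the same label on all its lines, so that colourings of different lines through it can be
  compared.\<close>

definition label :: "nat \<Rightarrow> nat \<Rightarrow> (nat \<Rightarrow> nat) \<Rightarrow> nat" where
  "label h r p = (\<Sum>a<h. p a) mod r"

text \<open>Two different points of a line differ in exactly one coordinate, so the description is
  proper on edges.\<close>

definition dir :: "(nat \<Rightarrow> nat) set \<Rightarrow> nat" where
  "dir e = (THE a. \<exists>p\<in>e. \<exists>q\<in>e. p a \<noteq> q a)"

lemma finite_cube: "finite (cube h r)"
  by (simp add: cube_def finite_PiE)

lemma line_subset: "line h r p a \<subseteq> cube h r"
  by (auto simp: line_def)

lemma line_refl: "p \<in> cube h r \<Longrightarrow> p \<in> line h r p a"
  by (simp add: line_def)

lemma line_sym: "q \<in> line h r p a \<Longrightarrow> p \<in> cube h r \<Longrightarrow> p \<in> line h r q a"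
  by (simp add: line_def)

lemma line_trans: "q \<in> line h r p a \<Longrightarrow> w \<in> line h r q a \<Longrightarrow> w \<in> line h r p a"
  by (simp add: line_def)

lemma line_eq: "q \<in> line h r p a \<Longrightarrow> line h r q a = line h r p a"
  by (auto simp: line_def)

lemma dir_eq:
  assumes "e \<in> pairs (line h r p a)"
  shows "dir e = a"
proof -
  obtain q w where e: "e = {q, w}" "q \<in> line h r p a" "w \<in> line h r p a" "q \<noteq> w"
    using assms by (rule pairsE)
  have "q b = w b" if "b \<noteq> a" for b using e that by (simp add: line_def)
  moreover from this have "q a \<noteq> w a" using e(4) by (metis ext)
  ultimately show ?thesis
    unfolding dir_def e(1) by (intro the_equality) auto
qed

lemma line_image:
  assumes "p \<in> cube h r" "a < h"
  shows "line h r p a = (\<lambda>x. p(a := x)) ` {..<r}"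
proof (intro equalityI subsetI)
  fix q assume q: "q \<in> line h r p a"
  then have "q = p(a := q a)" by (auto simp: line_def)
  moreover have "q a < r" using q assms(2) by (auto simp: line_def cube_def PiE_def Pi_def)
  ultimately show "q \<in> (\<lambda>x. p(a := x)) ` {..<r}" by blast
next
  fix q assume "q \<in> (\<lambda>x. p(a := x)) ` {..<r}"
  then show "q \<in> line h r p a"
    using assms by (auto simp: line_def cube_def PiE_def Pi_def extensional_def)
qed

lemma card_line:
  assumes "p \<in> cube h r" "a < h"
  shows "card (line h r p a) = r"
proof -
  have "inj_on (\<lambda>x. p(a := x)) {..<r}" by (metis fun_upd_same inj_onI)
  then show ?thesis using line_image[OF assms] by (simp add: card_image)
qed

text \<open>Along a line all summands but one are fixed, so the label is the moving coordinate
  shifted modulo \<open>r\<close>.\<close>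

lemma bij_betw_label_line:
  assumes "p \<in> cube h r" "a < h"
  shows "bij_betw (label h r) (line h r p a) {..<r}"
proof -
  have "inj_on (label h r) (line h r p a)"
  proof (rule inj_onI)
    fix q w assume q: "q \<in> line h r p a" and w: "w \<in> line h r p a" and eq: "label h r q = label h r w"
    have lt: "q a < r" "w a < r"
      using q w assms(2) by (auto simp: line_def cube_def PiE_def Pi_def)
    have same: "q b = w b" if "b \<noteq> a" for b using q w that by (simp add: line_def)
    have sum_split: "(\<Sum>b<h. f b) = (\<Sum>b\<in>{..<h} - {a}. f b) + f a" for f :: "nat \<Rightarrow> nat"
      using sum.remove[of "{..<h}" a f] assms(2) by simp
    have "(\<Sum>b\<in>{..<h} - {a}. q b) = (\<Sum>b\<in>{..<h} - {a}. w b)"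
      using same by (intro sum.cong) auto
    then have "(\<Sum>b\<in>{..<h} - {a}. q b) + q a = sum q {..<h}"
      "(\<Sum>b\<in>{..<h} - {a}. q b) + w a = sum w {..<h}"
      by (simp_all only: sum_split)
    then have "q a = w a"
      using eq lt unfolding label_def by (metis add_mod_cancel_left_nat)
    then show "q = w" using same by (metis ext)
  qed
  moreover have "r > 0"
    using assms by (auto simp: cube_def PiE_def Pi_def)
  then have "label h r ` line h r p a \<subseteq> {..<r}"
    by (auto simp: label_def)
  ultimately show ?thesis
    unfolding bij_betw_def using card_line[OF assms]
    by (metis card_image card_lessThan card_subset_eq finite_lessThan)
qed

lemma pairs_line_hamming:
  assumes "a < h"
  shows "pairs (line h r p a) \<subseteq> edges (hamming h r)"
proof
  fix e assume "e \<in> pairs (line h r p a)"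
  then obtain q w where e: "e = {q, w}" "q \<in> line h r p a" "w \<in> line h r p a" "q \<noteq> w"
    by (rule pairsE)
  then have "e \<subseteq> line h r q a" using line_eq[OF e(2)] by auto
  then show "e \<in> edges (hamming h r)"
    using e assms line_subset[of h r p a] by (auto simp: hamming_def)
qed

lemma hamming_edge:
  "{p, q} \<in> edges (hamming h r) \<longleftrightarrow> p \<in> cube h r \<and> q \<in> cube h r \<and> p \<noteq> q \<and> (\<exists>a<h. q \<in> line h r p a)"
  by (auto simp: hamming_def line_refl line_sym)

text \<open>If the second edge had a direction other than \<open>a\<close>, then \<open>w\<close>
  would differ from \<open>p\<close> in coordinate \<open>a\<close>, so the third edge has direction
  \<open>a\<close> anyway.\<close>

lemma hamming_triangle:
  assumes "{p, q} \<in> edges (hamming h r)" "{q, w} \<in> edges (hamming h r)" "{p, w} \<in> edges (hamming h r)"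
    and "q \<in> line h r p a"
  shows "w \<in> line h r p a"
proof -
  obtain b where b: "w \<in> line h r q b" using assms(2) by (auto simp: hamming_edge)
  obtain d where d: "w \<in> line h r p d" using assms(3) by (auto simp: hamming_edge)
  show ?thesis
  proof (cases "a = b")
    case True
    then show ?thesis using b assms(4) line_trans by blast
  next
    case False
    have "p \<noteq> q" using assms(1) by (simp add: hamming_edge)
    moreover have "p = q" if "p a = q a"
    proof
      show "p x = q x" for x
        using assms(4) that by (cases "x = a") (simp_all add: line_def)
    qed
    ultimately have "p a \<noteq> q a" by blast
    moreover have "w a = q a" using b False by (simp add: line_def)
    ultimately have "d = a" using d by (auto simp: line_def)
    then show ?thesis using d by simp
  qed
qed

context pendant_graph
begin

text \<open>Triangles force \<open>u\<close> and \<open>K\<close> onto one line, and the pendant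
  edge, in another direction, repeats a colour inside \<open>K\<close>. For bridging
  \<open>x\<close> in colour \<open>k\<close>, \<open>bridged_clique\<close> is applied to a line
  through \<open>x\<close> on which only edges at \<open>x\<close> may have colour
  \<open>k\<close>.\<close>

lemma rainbow_sat_le_hamming_gadget:
  assumes t: "t \<ge> (card (vertices H))\<^sup>2"
    and K: "pairs K \<subseteq> edges H" and b0: "b0 \<in> K" "\<And>b. b \<in> K \<Longrightarrow> {u, b} \<in> edges H \<longleftrightarrow> b \<noteq> b0"
    and r: "even (card K + 1)" "card K \<ge> 3"
  shows "\<exists>C. \<forall>n. rainbow_sat t n H \<le> C * n"
proof -
  define r where "r = card K + 1"
  define h where "h = r div 2"
  have r': "even r" "r \<ge> 2" using r by (simp_all add: r_def)
  obtain \<phi> :: "nat \<Rightarrow> nat set \<Rightarrow> nat" where range: "\<forall>a e. \<phi> a e \<in> {1..r\<^sup>2}"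
    and inj': "\<forall>a. inj_on (\<phi> a) (pairs {..<r})"
    and other: "\<forall>a<h. \<forall>b<h. \<forall>e\<in>pairs {..<r}. \<forall>i\<in>e. a \<noteq> b \<longrightarrow>
      (\<exists>e'\<in>pairs {..<r}. i \<notin> e' \<and> \<phi> a e' = \<phi> b e)"
    and avoid: "\<forall>k. \<forall>i<r. \<exists>a<h. \<forall>e\<in>pairs {..<r}. \<phi> a e = k \<longrightarrow> i \<in> e"
    using ex_rotating_colourings[OF r', folded h_def] by (elim exE conjE) (rule that; assumption)
  have inj: "inj_on (\<phi> a) (pairs {..<r})" for a using inj' by blast
  let ?G = "hamming h r"
  let ?l = "label h r"
  define c where "c e = \<phi> (dir e) (?l ` e)" for e
  have c_line: "c e = \<phi> a (?l ` e)" if "e \<in> pairs (line h r p a)" for e p a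
    using dir_eq[OF that] by (simp add: c_def)
  have label_pairs: "?l ` e \<in> pairs {..<r}" if "e \<in> pairs (line h r p a)" "p \<in> cube h r" "a < h" for e p a
    using pairs_image[of ?l "line h r p a" e] bij_betw_label_line[OF that(2,3)] that(1)
    by (simp add: bij_betw_def)
  have no: "\<not> has_rainbow_copy H ?G c"
  proof
    assume "has_rainbow_copy H ?G c"
    then obtain f where f: "rainbow_embedding H ?G c f"
      using has_rainbow_copy_iff[OF H] by blast
    have fE: "{f x, f y} \<in> edges ?G" if "{x, y} \<in> edges H" for x y
      using f that by (auto simp: rainbow_embedding_def dest: bspec[of _ _ "{x, y}"])
    have injf: "inj_on f (vertices H)" and injc: "inj_on (\<lambda>e. c (f ` e)) (edges H)"
      using f by (simp_all add: rainbow_embedding_def)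
    have fu: "f u \<in> cube h r" using fE[OF uv] by (simp add: hamming_edge)
    have "\<not> card (K - {b0}) \<le> Suc 0" using r b0 finite_K by simp
    then have "\<exists>b1\<in>K - {b0}. \<exists>b2\<in>K - {b0}. b1 \<noteq> b2"
      using card_le_Suc0_iff_eq[of "K - {b0}"] finite_K by simp
    then obtain b1 b2 where b: "b1 \<in> K" "b2 \<in> K" "b1 \<noteq> b0" "b2 \<noteq> b0" "b1 \<noteq> b2"
      by (elim bexE DiffE) simp
    have KE: "{x, y} \<in> edges H" if "x \<in> K" "y \<in> K" "x \<noteq> y" for x y
      using K that by auto
    have ub: "{u, b1} \<in> edges H" "{u, b2} \<in> edges H" using b b0(2) by auto
    obtain a where a: "a < h" "f b1 \<in> line h r (f u) a"
      using fE[OF ub(1)] by (auto simp: hamming_edge)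
    have line1: "f x \<in> line h r (f u) a" if "x \<in> K" "x \<noteq> b0" for x
    proof (cases "x = b1")
      case False
      then show ?thesis
        using hamming_triangle[OF fE fE fE a(2), of x] ub(1) KE[of b1 x] b0(2)[of x] b that by auto
    qed (use a in simp)
    \<comment> \<open>\<open>b0\<close> is not adjacent to \<open>u\<close> and is reached by the
      triangle of \<open>b1\<close>, \<open>b2\<close> and \<open>b0\<close>.\<close>
    have line0: "f b0 \<in> line h r (f u) a"
    proof -
      have "f b2 \<in> line h r (f b1) a"
        using line1[of b2] line_eq[OF a(2)] b by simp
      then have "f b0 \<in> line h r (f b1) a"
        using hamming_triangle[OF fE fE fE, of b1 b2 b0 a] KE b b0 by auto
      then show ?thesis using line_eq[OF a(2)] by simp
    qed
    let ?L = "line h r (f u) a"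
    have "f ` insert u K \<subseteq> ?L"
      using line0 line1 line_refl[OF fu] by auto
    \<comment> \<open>\<open>u\<close> and \<open>K\<close> are \<open>r\<close> vertices and so
      fill the line, leaving no room for \<open>v\<close>.\<close>
    moreover have "card (f ` insert u K) = card ?L"
      using card_line[OF fu a(1)] inj_on_subset[OF injf, of "insert u K"] finite_K uv_notin_K
      by (subst card_image) (auto simp: vertices_eq r_def)
    ultimately have fL: "f ` insert u K = ?L"
      by (rule card_subset_eq[OF finite_subset[OF line_subset finite_cube]])
    obtain a' where a': "a' < h" "f v \<in> line h r (f u) a'"
      using fE[OF uv] by (auto simp: hamming_edge)
    have "f v \<notin> ?L"
    proof
      assume "f v \<in> ?L"
      then obtain x where "x \<in> insert u K" "f x = f v" using fL by force
      then show False
        using inj_onD[OF injf, of x v] uv_notin_K uv_vertices by (auto simp: vertices_eq)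
    qed
    then have ne: "a \<noteq> a'" using a' by blast
    have fuv: "f ` {u, v} \<in> pairs (line h r (f u) a')"
      using a'(2) line_refl[OF fu] fE[OF uv] by (simp add: hamming_edge)
    \<comment> \<open>The colour of the pendant edge reappears in direction \<open>a\<close> on a
      pair that misses the label of \<open>f u\<close>; its preimage lies in the clique
      \<open>K\<close>.\<close>
    obtain e' where e': "e' \<in> pairs {..<r}" "?l (f u) \<notin> e'" "\<phi> a e' = \<phi> a' (?l ` f ` {u, v})"
      using other a(1) a'(1) label_pairs[OF fuv fu a'(1)] ne by (metis image_eqI insertI1)
    obtain i j where ij: "e' = {i, j}" "i \<in> {..<r}" "j \<in> {..<r}" "i \<noteq> j"
      using e'(1) by (rule pairsE)
    have lf: "?l ` f ` insert u K = {..<r}"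
      unfolding fL using bij_betw_label_line[OF fu a(1)] by (simp add: bij_betw_def)
    have pre: "\<exists>x. x \<in> insert u K \<and> ?l (f x) = i" if "i \<in> {..<r}" for i
      using that unfolding lf[symmetric] by blast
    obtain x where x: "x \<in> insert u K" "?l (f x) = i" using pre[OF ij(2)] by blast
    obtain y where y: "y \<in> insert u K" "?l (f y) = j" using pre[OF ij(3)] by blast
    note xy = x y
    have xy': "x \<in> K" "y \<in> K" "x \<noteq> y" using xy e'(2) ij by auto
    then have E: "{x, y} \<in> edges H" by (rule KE)
    have "f ` {x, y} \<in> pairs ?L"
      using xy' fL fE[OF E] by (auto simp: hamming_edge)
    then have "c (f ` {x, y}) = \<phi> a e'"
      using c_line[of "f ` {x, y}" "f u" a] xy ij by simp
    moreover have "c (f ` {u, v}) = \<phi> a' (?l ` f ` {u, v})"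
      using c_line[OF fuv] .
    ultimately have "{x, y} = {u, v}"
      using e'(3) inj_onD[OF injc _ E uv] by simp
    then show False using xy' uv_notin_K by (auto simp: doubleton_eq_iff)
  qed
  have "rainbow_sat t n H \<le> 2 * card (vertices ?G) * n" for n
  proof (rule rainbow_sat_le_gadget[OF H conn])
    show "simple_graph ?G"
      by (auto simp: simple_graph_def hamming_def finite_cube)
    have "(\<lambda>a\<in>{..<h}. 0) \<in> cube h r" using r' by (auto simp: cube_def)
    then show "vertices ?G \<noteq> {}" by (auto simp: hamming_def)
    have "r\<^sup>2 \<le> t"
      using t by (rule order_trans[rotated]) (simp add: card_vertices r_def)
    then have "\<phi> a e \<in> {1..t}" for a e
      using range by (meson atLeastAtMost_iff order_trans)
    then show "edge_colouring t ?G c"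
      by (simp add: edge_colouring_def c_def)
    show "\<not> has_rainbow_copy H ?G c" by (rule no)
    fix x y k assume "x \<in> vertices ?G" "y \<in> vertices ?G"
    then have x: "x \<in> cube h r" and y: "y \<in> vertices ?G" by (simp_all add: hamming_def)
    have "?l x < r" using r' by (simp add: label_def)
    then obtain a where a: "a < h" "\<forall>e\<in>pairs {..<r}. \<phi> a e = k \<longrightarrow> ?l x \<in> e"
      using avoid by blast
    let ?L = "line h r x a"
    have xL: "x \<in> ?L" using line_refl[OF x] .
    have linj: "inj_on ?l ?L" using bij_betw_label_line[OF x a(1)] by (simp add: bij_betw_def)
    have "bridged H ?G c x y k"
    proof (rule bridged_clique[of ?L])
      show "?L \<subseteq> vertices ?G" using line_subset by (simp add: hamming_def)
      show "pairs ?L \<subseteq> edges ?G" using pairs_line_hamming[OF a(1)] .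
      show "finite ?L" using finite_subset[OF line_subset finite_cube] .
      show "card ?L = card K + 1" using card_line[OF x a(1)] by (simp add: r_def)
      show "inj_on c (pairs ?L)"
      proof (rule inj_onI)
        fix e e' assume e: "e \<in> pairs ?L" "e' \<in> pairs ?L" "c e = c e'"
        then have "?l ` e = ?l ` e'"
          using inj_onD[OF inj _ label_pairs[OF _ x a(1)] label_pairs[OF _ x a(1)]] c_line by metis
        then show "e = e'" using inj_onD[OF inj_on_image_pairs[OF linj]] e by blast
      qed
      show "(\<forall>e\<in>pairs ?L. c e = k \<longrightarrow> x \<in> e) \<or> \<not> pairs K \<subseteq> edges H"
      proof (intro disjI1 ballI impI)
        fix e assume e: "e \<in> pairs ?L" "c e = k"
        then have "?l x \<in> ?l ` e"
          using a(2) label_pairs[OF e(1) x a(1)] c_line[OF e(1)] by simp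
        then show "x \<in> e"
          using linj e(1) xL by (auto simp: pairs_def dest!: inj_onD)
      qed
    qed (use xL y in auto)
    then show "bridged H ?G c x y k \<or> bridged H ?G c y x k" ..
  qed
  then show ?thesis by blast
qed

end

section \<open>Two cliques with spokes, for \<open>K\<close> a clique and 2 <= d <= |K| - 2\<close>

section \<open>Cliques with a vertex of smaller degree\<close>

text \<open>Two rainbow cliques on \<open>{0} \<times> {..<m}\<close> and \<open>{1} \<times> {..<m}\<close> with disjoint palettes of size
  \<open>M\<close>; each outer vertex \<open>(2, j)\<close> is joined to the first \<open>d + 1\<close> vertices of both cliques, by
  colours that belong to the palette of the other clique. In \<open>spoke_colour\<close>, the sum has a single
  term, and the maximum is the common first coordinate of the ends of a clique edge.\<close>
definition spoke_vertices :: "nat \<Rightarrow> nat \<Rightarrow> (nat \<times> nat) set" where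
  "spoke_vertices m l = {0, 1} \<times> {..<m} \<union> {2} \<times> {..<l}"

definition spoke_adj :: "nat \<Rightarrow> nat \<times> nat \<Rightarrow> nat \<times> nat \<Rightarrow> bool" where
  "spoke_adj d p q \<longleftrightarrow> fst p = fst q \<and> fst p < 2 \<or>
     fst p = 2 \<and> fst q < 2 \<and> snd q \<le> d \<or> fst q = 2 \<and> fst p < 2 \<and> snd p \<le> d"

definition spoke_graph :: "nat \<Rightarrow> nat \<Rightarrow> nat \<Rightarrow> (nat \<times> nat) ugraph" where
  "spoke_graph m d l = \<lparr>vertices = spoke_vertices m l,
     edges = {e \<in> pairs (spoke_vertices m l). \<exists>p q. e = {p, q} \<and> spoke_adj d p q}\<rparr>"

definition spoke_colour :: "nat \<Rightarrow> (nat set \<Rightarrow> nat) \<Rightarrow> (nat \<times> nat) set \<Rightarrow> nat" where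
  "spoke_colour M c e =
     (if 2 \<in> fst ` e then (\<Sum>(i, a)\<in>e - {2} \<times> UNIV. (1 - i) * M + (1 + a))
      else Max (fst ` e) * M + c (snd ` e))"

lemma spoke_adj_sym: "spoke_adj d p q \<longleftrightarrow> spoke_adj d q p"
  by (auto simp: spoke_adj_def)

lemma spoke_edge:
  "{p, q} \<in> edges (spoke_graph m d l) \<longleftrightarrow>
     p \<in> spoke_vertices m l \<and> q \<in> spoke_vertices m l \<and> p \<noteq> q \<and> spoke_adj d p q"
proof -
  have "(\<exists>p' q'. {p, q} = {p', q'} \<and> spoke_adj d p' q') \<longleftrightarrow> spoke_adj d p q"
    using spoke_adj_sym[of d p q] unfolding doubleton_eq_iff by blast
  then show ?thesis by (simp add: spoke_graph_def)
qed

lemma spoke_colour_clique: "i < 2 \<Longrightarrow> spoke_colour M c {(i, a), (i, b)} = i * M + c {a, b}"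
  by (simp add: spoke_colour_def)

lemma spoke_colour_outer:
  assumes "i < 2"
  shows "spoke_colour M c {(2, j), (i, a)} = (1 - i) * M + (1 + a)"
proof -
  have "{(2, j), (i, a)} - {2} \<times> UNIV = {(i, a)}" using assms by auto
  then show ?thesis by (simp add: spoke_colour_def)
qed

lemma finite_spoke_vertices: "finite (spoke_vertices m l)"
  by (simp add: spoke_vertices_def)

lemma card_spoke_vertices: "card (spoke_vertices m l) = 2 * m + l"
  unfolding spoke_vertices_def
  by (subst card_Un_disjoint) (auto simp: card_cartesian_product)

lemma simple_spoke_graph: "simple_graph (spoke_graph m d l)"
  by (auto simp: simple_graph_def spoke_graph_def finite_spoke_vertices)

context pendant_graph
begin

text \<open>If \<open>K\<close> avoids outer vertices, it fills one clique; then \<open>u\<close> is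
  outer, \<open>v\<close> lies in the other clique, and the colour of \<open>uv\<close> recurs in
  \<open>K\<close>. If \<open>K\<close> has an outer vertex \<open>z\<close>, the rest of
  \<open>K\<close> occupies all d + 1 attached vertices of one clique, and \<open>u\<close> and
  \<open>v\<close> cannot both be placed.\<close>

lemma no_rainbow_copy_spoke_graph:
  fixes M d :: nat
  assumes K: "pairs K \<subseteq> edges H"
    and N: "card {b \<in> K. {u, b} \<in> edges H} = d" "2 \<le> d" "d + 2 \<le> card K"
    and c: "bij_betw c (pairs {..<card K}) {1..M}" and M: "d + 1 \<le> M"
  shows "\<not> has_rainbow_copy H (spoke_graph (card K) d l) (spoke_colour M c)"
proof
  let ?m = "card K"
  let ?G = "spoke_graph ?m d l"
  let ?C = "spoke_colour M c"
  assume "has_rainbow_copy H ?G ?C"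
  then obtain f where f: "rainbow_embedding H ?G ?C f"
    using has_rainbow_copy_iff[OF H] by blast
  have fE: "f x \<in> spoke_vertices ?m l" "f y \<in> spoke_vertices ?m l" "spoke_adj d (f x) (f y)"
    if "{x, y} \<in> edges H" for x y
  proof -
    have "f ` {x, y} \<in> edges ?G" using f that by (simp add: rainbow_embedding_def del: image_insert)
    then have "{f x, f y} \<in> edges ?G" by simp
    then show "f x \<in> spoke_vertices ?m l" "f y \<in> spoke_vertices ?m l" "spoke_adj d (f x) (f y)"
      unfolding spoke_edge by auto
  qed
  have injf: "inj_on f (vertices H)" and injc: "inj_on (\<lambda>e. ?C (f ` e)) (edges H)"
    using f by (simp_all add: rainbow_embedding_def)
  have KE: "{x, y} \<in> edges H" if "x \<in> K" "y \<in> K" "x \<noteq> y" for x y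
    using K that by auto
  have fV: "f x \<in> spoke_vertices ?m l" if "x \<in> vertices H" for x
    using f that by (auto simp: rainbow_embedding_def spoke_graph_def)
  have KV: "x \<in> vertices H" if "x \<in> K" for x using that by (simp add: vertices_eq)
  have f_eq: "x = y" if "f x = f y" "x \<in> vertices H" "y \<in> vertices H" for x y
    using injf that by (auto dest: inj_onD)
  have C_eq: "{x, y} = {x', y'}"
    if "{x, y} \<in> edges H" "{x', y'} \<in> edges H" "?C {f x, f y} = ?C {f x', f y'}" for x y x' y'
    using inj_onD[OF injc _ that(1,2)] that(3) by simp
  have injK: "inj_on f K" using injf by (rule inj_on_subset) (auto simp: KV)
  have vert: "fst p < 2 \<and> snd p < ?m \<or> fst p = 2" if "p \<in> spoke_vertices ?m l" for p
    using that by (auto simp: spoke_vertices_def)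
  have "finite {b \<in> K. {u, b} \<in> edges H}" using finite_K by simp
  then have "\<exists>a1 a2. a1 \<in> K \<and> a2 \<in> K \<and> {u, a1} \<in> edges H \<and> {u, a2} \<in> edges H \<and> a1 \<noteq> a2"
    using N(1,2) card_le_Suc0_iff_eq[of "{b \<in> K. {u, b} \<in> edges H}"] by fastforce
  then obtain a1 a2 where a12: "a1 \<in> K" "a2 \<in> K" "{u, a1} \<in> edges H" "{u, a2} \<in> edges H" "a1 \<noteq> a2"
    by blast
  have same_side: "fst (f x) = fst (f y)" if "x \<in> K" "y \<in> K" "fst (f x) \<noteq> 2" "fst (f y) \<noteq> 2" for x y
    using fE(3)[OF KE[of x y]] that by (cases "x = y") (auto simp: spoke_adj_def)
  show False
  proof (cases "\<exists>z\<in>K. fst (f z) = 2")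
    case False
    define i where "i = fst (f a1)"
    have side: "fst (f x) = i" if "x \<in> K" for x
      using same_side[OF that a12(1)] False that a12(1) by (simp add: i_def)
    have i: "i < 2" using vert[OF fV[OF KV[OF a12(1)]]] False a12(1) by (auto simp: i_def)
    have "f ` K \<subseteq> {i} \<times> {..<?m}"
    proof
      fix p assume "p \<in> f ` K"
      then obtain x where x: "x \<in> K" "p = f x" by blast
      then show "p \<in> {i} \<times> {..<?m}"
        using vert[OF fV[OF KV[OF x(1)]]] side[OF x(1)] i by (simp add: mem_Times_iff)
    qed
    moreover have "card (f ` K) = card ({i} \<times> {..<?m})"
      using injK by (simp add: card_image card_cartesian_product)
    ultimately have fK: "f ` K = {i} \<times> {..<?m}" by (intro card_subset_eq) auto
    have not_in: "f x \<notin> {i} \<times> {..<?m}" if "x \<in> {u, v}" for x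
    proof
      assume "f x \<in> {i} \<times> {..<?m}"
      then obtain y where "y \<in> K" "f x = f y" unfolding fK[symmetric] by blast
      then show False using f_eq[of x y] KV that uv_vertices uv_notin_K by auto
    qed
    have outer: "fst (f u) = 2"
    proof (rule ccontr)
      assume "fst (f u) \<noteq> 2"
      moreover from this have "fst (f u) = i"
        using fE(3)[OF a12(3)] side[OF a12(1)] i by (auto simp: spoke_adj_def)
      ultimately show False
        using not_in[of u] vert[OF fV[OF uv_vertices(1)]] by (cases "f u") auto
    qed
    have v: "fst (f v) < 2" "snd (f v) \<le> d"
      using fE(3)[OF uv] outer by (auto simp: spoke_adj_def)
    have "fst (f v) \<noteq> i"
      using not_in[of v] vert[OF fV[OF uv_vertices(2)]] i by (cases "f v") auto
    then have "1 - fst (f v) = i" using v(1) i by auto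
    moreover have "?C {f u, f v} = (1 - fst (f v)) * M + (1 + snd (f v))"
      using spoke_colour_outer[OF v(1), of M c "snd (f u)" "snd (f v)"] outer
      by (metis prod.collapse)
    ultimately have Cuv: "?C {f u, f v} = i * M + (1 + snd (f v))" by simp
    \<comment> \<open>By \<open>d + 1 \<le> M\<close> the colour of this spoke is one that the
      clique filled by \<open>K\<close> does use.\<close>
    have "1 + snd (f v) \<in> {1..M}" using v M by simp
    then have "1 + snd (f v) \<in> c ` pairs {..<?m}" using c by (simp add: bij_betw_def)
    then obtain e where e: "e \<in> pairs {..<?m}" "1 + snd (f v) = c e" by blast
    obtain p q where pq: "e = {p, q}" "p \<in> {..<?m}" "q \<in> {..<?m}" "p \<noteq> q"
      using e(1) by (rule pairsE)
    have "(i, p) \<in> f ` K" "(i, q) \<in> f ` K" unfolding fK using pq by auto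
    then obtain x y where xy: "x \<in> K" "f x = (i, p)" "y \<in> K" "f y = (i, q)"
      by (elim imageE) simp
    have "x \<noteq> y" using xy pq by auto
    then have E: "{x, y} \<in> edges H" using KE xy by simp
    have "?C {f x, f y} = i * M + c e"
      using xy pq i by (simp add: spoke_colour_clique)
    then have "{x, y} = {u, v}"
      using C_eq[OF E uv] Cuv e(2) by simp
    then show False using xy uv_notin_K by (auto simp: doubleton_eq_iff)
  next
    case True
    then obtain z where z: "z \<in> K" "fst (f z) = 2" by blast
    have core: "fst (f x) < 2" "snd (f x) \<le> d" if "x \<in> K" "x \<noteq> z" for x
      using fE(3)[OF KE[OF that(1) z(1) that(2)]] z(2) by (auto simp: spoke_adj_def)
    obtain a where a: "a \<in> K" "{u, a} \<in> edges H" "a \<noteq> z"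
      using a12 by metis
    define i where "i = fst (f a)"
    have i: "i < 2" using core a by (simp add: i_def)
    have side: "fst (f x) = i" if "x \<in> K" "x \<noteq> z" for x
      using same_side[OF that(1) a(1)] core[OF that] core(1)[OF a(1,3)] by (simp add: i_def)
    have sub: "f ` (K - {z}) \<subseteq> {i} \<times> {..d}"
    proof
      fix p assume "p \<in> f ` (K - {z})"
      then obtain x where x: "x \<in> K" "x \<noteq> z" "p = f x" by blast
      then show "p \<in> {i} \<times> {..d}"
        using core(2)[OF x(1,2)] side[OF x(1,2)] by (simp add: mem_Times_iff)
    qed
    have card_f: "card (f ` (K - {z})) = ?m - 1"
      using inj_on_subset[OF injK, of "K - {z}"] finite_K z(1) by (simp add: card_image)
    moreover have "card (f ` (K - {z})) \<le> card ({i} \<times> {..d})"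
      using sub by (intro card_mono) auto
    ultimately have m: "?m = d + 2" using N(3) by (simp add: card_cartesian_product)
    then have fK: "f ` (K - {z}) = {i} \<times> {..d}"
      using sub card_f by (intro card_subset_eq) (auto simp: card_cartesian_product)
    have not_in: "f x \<notin> {i} \<times> {..d}" if "x \<in> {u, v}" for x
    proof
      assume "f x \<in> {i} \<times> {..d}"
      then obtain y where "y \<in> K" "f x = f y" unfolding fK[symmetric] by blast
      then show False using f_eq[of x y] KV that uv_vertices uv_notin_K by auto
    qed
    have fa: "f a = (i, snd (f a))" by (simp add: i_def)
    show False
    proof (cases "fst (f u) = 2")
      case True
      \<comment> \<open>The colour of a spoke depends only on its inner end, so the outer vertices
        \<open>u\<close> and \<open>z\<close> would give \<open>a\<close> two edges of one
        colour.\<close>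
      have "?C {f u, f a} = (1 - i) * M + (1 + snd (f a))"
        using spoke_colour_outer[OF i, of M c "snd (f u)" "snd (f a)"] True fa
        by (metis prod.collapse)
      moreover have "?C {f z, f a} = (1 - i) * M + (1 + snd (f a))"
        using spoke_colour_outer[OF i, of M c "snd (f z)" "snd (f a)"] z(2) fa
        by (metis prod.collapse)
      ultimately have "{u, a} = {z, a}"
        using C_eq[OF a(2) KE[OF z(1) a(1)]] a(3) by simp
      then show False using z(1) uv_notin_K a(3) by (auto simp: doubleton_eq_iff)
    next
      case False
      then have u: "fst (f u) = i"
        using fE(3)[OF a(2)] fa i by (auto simp: spoke_adj_def i_def)
      \<comment> \<open>The one free place on side \<open>i\<close> has index \<open>d + 1\<close>
        and no spokes; \<open>u\<close> goes there, and \<open>v\<close> would have to go there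
        too.\<close>
      have nd: "\<not> snd (f u) \<le> d"
        using not_in[of u] u by (cases "f u") auto
      then have u': "snd (f u) = d + 1"
        using vert[OF fV[OF uv_vertices(1)]] u i m by simp
      have v: "fst (f v) = i"
        using fE(3)[OF uv] u nd i by (auto simp: spoke_adj_def)
      have "\<not> snd (f v) \<le> d"
        using not_in[of v] v by (cases "f v") auto
      then have "snd (f v) = d + 1"
        using vert[OF fV[OF uv_vertices(2)]] v i m by simp
      then have "f u = f v" using u u' v by (simp add: prod_eq_iff)
      then show False using f_eq uv_vertices by blast
    qed
  qed
qed

text \<open>The new edge plays \<open>uv\<close>, and \<open>K\<close> fills a clique whose palette
  lacks \<open>k\<close>. Of the d + 1 spokes at \<open>u\<close> into it at most one has colour
  \<open>k\<close>, so d remain for the neighbours of \<open>u\<close>.\<close>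

lemma has_rainbow_copy_spoke_graph:
  fixes M d k :: nat
  assumes N: "card {b \<in> K. {u, b} \<in> edges H} = d" "d + 2 \<le> card K"
    and c: "bij_betw c (pairs {..<card K}) {1..M}" and M: "d + 1 \<le> M"
    and j: "j < l" "j' < l" "j \<noteq> j'"
  defines "G \<equiv> spoke_graph (card K) d l" and "e0 \<equiv> {(2, j), (2, j')}"
  shows "has_rainbow_copy H (G\<lparr>edges := insert e0 (edges G)\<rparr>) ((spoke_colour M c)(e0 := k))"
proof -
  let ?m = "card K"
  let ?N = "{b \<in> K. {u, b} \<in> edges H}"
  let ?C = "(spoke_colour M c)(e0 := k)"
  \<comment> \<open>Clique 0 uses the colours up to \<open>M\<close>, clique 1 those above, so this
    choice keeps \<open>k\<close> out of clique \<open>i\<close>.\<close>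
  define i :: nat where "i = (if k \<le> M then 1 else 0)"
  have i: "i < 2" by (simp add: i_def)
  have k: "k \<noteq> i * M + x" if "x \<in> {1..M}" for x using that by (auto simp: i_def)
  define S where "S = {a. a \<le> d \<and> (1 - i) * M + (1 + a) \<noteq> k}"
  \<comment> \<open>Only this index can give colour \<open>k\<close>; if the subtraction truncates,
    at most the index 0 is discarded needlessly.\<close>
  have "{..d} - {k - (1 - i) * M - 1} \<subseteq> S" by (auto simp: S_def)
  moreover have "card ({..d} - {k - (1 - i) * M - 1}) \<ge> d"
    by (simp add: card_Diff_singleton_if)
  moreover have finS: "finite S" by (simp add: S_def)
  ultimately have "card ?N \<le> card S"
    unfolding N(1) by (meson card_mono order_trans)
  then obtain g where g: "g ` ?N \<subseteq> S" "inj_on g ?N"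
    using card_le_inj[of ?N S] finS finite_K by auto
  have "S \<subseteq> {..<?m}" using N(2) by (auto simp: S_def)
  then obtain h where h: "bij_betw h K {..<?m}" "\<forall>b\<in>?N. h b = g b"
    using ex_bij_betw_extending[of K "{..<?m}" ?N g] g finite_K by auto
  have hS: "h b \<in> S" if "b \<in> ?N" for b using h(2) g(1) that by auto
  have injh: "inj_on h K" and imh: "h ` K = {..<?m}" using h(1) by (simp_all add: bij_betw_def)
  have hm: "h b < ?m" if "b \<in> K" for b using imh that by blast
  define f where "f b = (if b = u then (2, j) else if b = v then (2, j') else (i, h b))" for b
  have fu: "f u = (2, j)" and fv: "f v = (2, j')" using uv_vertices by (simp_all add: f_def)
  have fb: "f b = (i, h b)" if "b \<in> K" for b using that uv_notin_K by (auto simp: f_def)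
  have injf: "inj_on f (vertices H)"
  proof (rule inj_onI)
    fix x y assume "x \<in> vertices H" "y \<in> vertices H" "f x = f y"
    then show "x = y"
      using fu fv fb i j inj_onD[OF injh, of x y] by (auto simp: vertices_eq)
  qed
  have fV: "f ` vertices H \<subseteq> spoke_vertices ?m l"
    using fu fv fb i j hm by (auto simp: vertices_eq spoke_vertices_def)
  have e0: "f ` {u, v} = e0" using fu fv by (simp add: e0_def)
  have ne0: "e \<noteq> e0" if "(i, x) \<in> e" for e x using that i by (auto simp: e0_def)
  have C1: "?C (f ` {u, v}) = k" unfolding e0 by simp
  have C2: "?C (f ` {u, b}) = (1 - i) * M + (1 + h b)" if "b \<in> K" for b
  proof -
    have "f ` {u, b} = {(2, j), (i, h b)}" using fu fb[OF that] by simp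
    then show ?thesis using ne0[of "h b" "f ` {u, b}"] spoke_colour_outer[OF i] by simp
  qed
  have C3: "?C (f ` e) = i * M + c (h ` e)" "h ` e \<in> pairs {..<?m}" "f ` e \<in> edges G"
    if "e \<in> pairs K" for e
  proof -
    show "h ` e \<in> pairs {..<?m}" using pairs_image[OF injh that] imh by simp
    from that obtain x y where xy: "e = {x, y}" "x \<in> K" "y \<in> K" "x \<noteq> y" by (rule pairsE)
    have fe: "f ` e = {(i, h x), (i, h y)}" using fb xy by simp
    show "?C (f ` e) = i * M + c (h ` e)"
      unfolding fe using ne0[of "h x" "{(i, h x), (i, h y)}"] spoke_colour_clique[OF i] xy by simp
    have "h x \<noteq> h y" using inj_onD[OF injh] xy by blast
    then show "f ` e \<in> edges G"
      unfolding fe G_def spoke_edge using hm xy i by (auto simp: spoke_adj_def spoke_vertices_def)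
  qed
  have c_range: "c (h ` e) \<in> {1..M}" if "e \<in> pairs K" for e
    using C3(2)[OF that] by (rule bij_betwE[OF c, rule_format])
  have i_cases: "i = 0 \<or> i = 1" by (auto simp: i_def)
  have neq12: "(1 - i) * M + (1 + h b) \<noteq> k" if "b \<in> ?N" for b
    using hS[OF that] by (simp add: S_def)
  have neq13: "i * M + c (h ` e) \<noteq> k" if "e \<in> pairs K" for e
    using k[OF c_range[OF that]] by simp
  have neq23: "(1 - i) * M + (1 + h b) \<noteq> i * M + c (h ` e)" if "b \<in> ?N" "e \<in> pairs K" for b e
  proof -
    have "h b \<le> d" using hS[OF that(1)] by (simp add: S_def)
    then have "1 + h b \<in> {1..M}" using M by simp
    then show ?thesis using c_range[OF that(2)] i_cases by auto
  qed
  have edge: "e = {u, v} \<or> (\<exists>b\<in>?N. e = {u, b}) \<or> e \<in> pairs K" if "e \<in> edges H" for e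
    using that by (cases rule: edge_cases) (use that in auto)
  have "inj_on (\<lambda>e. ?C (f ` e)) (edges H)"
  proof (rule inj_onI)
    have uv_other: "e' = {u, v}" if "e' \<in> edges H" "?C (f ` e') = k" for e'
      using edge[OF that(1)]
    proof (elim disjE bexE)
      fix b assume b: "b \<in> ?N" "e' = {u, b}"
      then show ?thesis using neq12[OF b(1)] C2[of b] that(2) by simp
    next
      assume e': "e' \<in> pairs K"
      then show ?thesis using neq13[OF e'] C3(1)[OF e'] that(2) by simp
    qed
    fix e e' assume e: "e \<in> edges H" "e' \<in> edges H" and eq: "?C (f ` e) = ?C (f ` e')"
    consider "e = {u, v} \<or> e' = {u, v}" | b b' where "b \<in> ?N" "e = {u, b}" "b' \<in> ?N" "e' = {u, b'}"
      | b where "b \<in> ?N" "e = {u, b}" "e' \<in> pairs K" | b where "b \<in> ?N" "e' = {u, b}" "e \<in> pairs K"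
      | "e \<in> pairs K" "e' \<in> pairs K"
      using edge[OF e(1)] edge[OF e(2)] by blast
    then show "e = e'"
    proof cases
      case 1
      then show ?thesis using uv_other e eq C1 by metis
    next
      case (2 b b')
      then have "h b = h b'" using C2[of b] C2[of b'] eq by simp
      then show ?thesis using inj_onD[OF injh, of b b'] 2 by simp
    next
      case (3 b)
      then show ?thesis using neq23[OF 3(1,3)] C2[of b] C3(1)[OF 3(3)] eq by simp
    next
      case (4 b)
      then show ?thesis using neq23[OF 4(1,3)] C2[of b] C3(1)[OF 4(3)] eq by simp
    next
      case 5
      then have "c (h ` e) = c (h ` e')" using C3(1)[OF 5(1)] C3(1)[OF 5(2)] eq by simp
      then have "h ` e = h ` e'"
        using c C3(2)[OF 5(1)] C3(2)[OF 5(2)] by (meson bij_betw_imp_inj_on inj_onD)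
      then show ?thesis using inj_onD[OF inj_on_image_pairs[OF injh]] 5 by blast
    qed
  qed
  moreover have "f ` e \<in> insert e0 (edges G)" if "e \<in> edges H" for e
    using edge[OF that]
  proof (elim disjE bexE)
    assume "e = {u, v}"
    then show ?thesis using e0 by simp
  next
    fix b assume b: "b \<in> ?N" "e = {u, b}"
    then have "f ` e = {(2, j), (i, h b)}" using fu fb[of b] by simp
    moreover have "h b \<le> d" "h b < ?m" using hS[OF b(1)] hm[of b] b(1) by (simp_all add: S_def)
    ultimately have "f ` e \<in> edges G"
      using i j by (auto simp: G_def spoke_edge spoke_adj_def spoke_vertices_def)
    then show ?thesis by simp
  qed (use C3(3) in simp)
  ultimately have "rainbow_embedding H (G\<lparr>edges := insert e0 (edges G)\<rparr>) ?C f"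
    unfolding rainbow_embedding_def using injf fV by (simp add: G_def spoke_graph_def)
  then show ?thesis using has_rainbow_copy_iff[OF H] by blast
qed

text \<open>A single spoke graph on all \<open>n\<close> vertices serves here, and \<open>B\<close>
  collects the pairs that meet the two cliques.\<close>

lemma rainbow_sat_le_spoke_graph:
  assumes t: "t \<ge> (card (vertices H))\<^sup>2" and K: "pairs K \<subseteq> edges H"
    and N: "card {b \<in> K. {u, b} \<in> edges H} = d" "2 \<le> d" "d + 2 \<le> card K"
    and n: "n \<ge> 2 * card K"
  shows "rainbow_sat t n H \<le> 2 * card K * n"
proof -
  let ?m = "card K"
  define M where "M = ?m choose 2"
  obtain c where c: "bij_betw c (pairs {..<?m}) {1..M}"
    using ex_bij_colouring[of "{..<?m}"] by (auto simp: M_def)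
  have "even (?m * (?m - 1))" by (cases ?m) auto
  then have M2: "2 * M = ?m * (?m - 1)" by (simp add: M_def choose_two)
  \<comment> \<open>The factors compare one by one, since \<open>2 \<le> ?m\<close> and
    \<open>d + 1 \<le> ?m - 1\<close>.\<close>
  have "2 * (d + 1) \<le> ?m * (?m - 1)" using N by (intro mult_le_mono) auto
  then have "2 * (d + 1) \<le> 2 * M" unfolding M2 .
  then have M: "d + 1 \<le> M" by simp
  have "2 * M \<le> (card (vertices H))\<^sup>2"
    unfolding M2 card_vertices power2_eq_square by (intro mult_le_mono) auto
  then have Mt: "2 * M \<le> t" using t by simp
  define l where "l = n - 2 * ?m"
  let ?G = "spoke_graph ?m d l"
  let ?V = "spoke_vertices ?m l"
  let ?core = "{0, 1 :: nat} \<times> {..<?m}"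
  define B where "B = (\<lambda>(p, q). {p, q}) ` (?V \<times> ?core)"
  have cardV: "card ?V = n" using n by (simp add: card_spoke_vertices l_def)
  have finB: "finite B" by (simp add: B_def finite_spoke_vertices)
  have "card B \<le> card (?V \<times> ?core)"
    unfolding B_def by (intro card_image_le) (simp add: finite_spoke_vertices)
  then have cardB: "card B \<le> 2 * ?m * n"
    by (simp add: card_cartesian_product cardV mult_2 mult_ac)
  have memB: "{p, q} \<in> B" if "p \<in> ?V" "q \<in> ?core" for p q
    unfolding B_def using that by (intro image_eqI[of _ _ "(p, q)"]) auto
  have "rainbow_sat t (card (vertices ?G)) H \<le> card B"
  proof (rule rainbow_sat_le_card[OF H simple_spoke_graph, where c = "spoke_colour M c"])
    have edge: "\<exists>i a b. i < 2 \<and> a < ?m \<and> b < ?m \<and> a \<noteq> b \<and> e = {(i, a), (i, b)} \<or>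
        (\<exists>i j a. i < 2 \<and> a \<le> d \<and> e = {(2, j), (i, a)} \<and> (2, j) \<in> ?V)" if "e \<in> edges ?G" for e
    proof -
      from that obtain p q where e: "e = {p, q}"
        by (auto simp: spoke_graph_def)
      obtain i a i' b where p: "p = (i, a)" and q: "q = (i', b)" by (cases p, cases q) auto
      have pq: "p \<in> ?V" "q \<in> ?V" "p \<noteq> q" "spoke_adj d p q"
        using that unfolding e spoke_edge by auto
      consider "i = i'" "i < 2" | "i = 2" "i' < 2" "b \<le> d" | "i' = 2" "i < 2" "a \<le> d"
        using pq(4) p q by (auto simp: spoke_adj_def)
      then show ?thesis
      proof cases
        case 1
        then have "a < ?m" "b < ?m" "a \<noteq> b" using pq p q by (auto simp: spoke_vertices_def)
        then show ?thesis using 1 unfolding e p q by blast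
      next
        case 2
        moreover have "(2, a) \<in> ?V" using pq(1) p 2(1) by simp
        ultimately show ?thesis unfolding e p q by blast
      next
        case 3
        moreover have "(2, b) \<in> ?V" using pq(2) q 3(1) by simp
        moreover have "e = {(2, b), (i, a)}" unfolding e p q using 3(1) by (simp add: insert_commute)
        ultimately show ?thesis by blast
      qed
    qed
    show "edge_colouring t ?G (spoke_colour M c)"
      unfolding edge_colouring_def
    proof
      fix e assume "e \<in> edges ?G"
      from edge[OF this] show "spoke_colour M c e \<in> {1..t}"
      proof (elim exE disjE conjE)
        fix i a b :: nat assume *: "i < 2" "a < ?m" "b < ?m" "a \<noteq> b" "e = {(i, a), (i, b)}"
        have "c {a, b} \<in> {1..M}"
          using *(2-4) by (intro bij_betwE[OF c, rule_format]) simp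
        moreover have "i * M \<le> 1 * M" using *(1) by (intro mult_le_mono1) simp
        ultimately have "i * M + c {a, b} \<in> {1..t}"
          using Mt unfolding atLeastAtMost_iff by linarith
        then show ?thesis using * by (simp only: spoke_colour_clique)
      next
        fix i j a :: nat assume *: "i < 2" "a \<le> d" "e = {(2, j), (i, a)}"
        have "(1 - i) * M \<le> 1 * M" by (intro mult_le_mono1) simp
        then have "(1 - i) * M + (1 + a) \<in> {1..t}"
          using *(2) Mt M unfolding atLeastAtMost_iff by linarith
        then show ?thesis using *(1,3) by (simp only: spoke_colour_outer)
      qed
    qed
    show "\<not> has_rainbow_copy H ?G (spoke_colour M c)"
      using no_rainbow_copy_spoke_graph[OF K N c M] .
    show "edges ?G \<subseteq> B"
    proof
      fix e assume "e \<in> edges ?G"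
      from edge[OF this] show "e \<in> B"
      proof (elim exE disjE conjE)
        fix i a b :: nat assume *: "i < 2" "a < ?m" "b < ?m" "a \<noteq> b" "e = {(i, a), (i, b)}"
        then show ?thesis unfolding *(5) by (intro memB) (auto simp: spoke_vertices_def)
      next
        fix i j a :: nat assume *: "i < 2" "a \<le> d" "e = {(2, j), (i, a)}" "(2, j) \<in> ?V"
        then show ?thesis unfolding *(3) using N by (intro memB) auto
      qed
    qed
    show "finite B" by (rule finB)
  next
    fix e k assume "e \<in> pairs (vertices ?G) - B"
    then have e: "e \<in> pairs ?V" "e \<notin> B" by (auto simp: spoke_graph_def)
    from e(1) show "has_rainbow_copy H (?G\<lparr>edges := insert e (edges ?G)\<rparr>) ((spoke_colour M c)(e := k))"
    proof (rule pairsE)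
      fix p q assume pq: "e = {p, q}" "p \<in> ?V" "q \<in> ?V" "p \<noteq> q"
      have "p \<notin> ?core" "q \<notin> ?core"
        using memB[of p q] memB[of q p] pq e(2) by (auto simp: insert_commute)
      then obtain j j' where "p = (2, j)" "q = (2, j')" "j < l" "j' < l"
        using pq(2,3) unfolding spoke_vertices_def by blast
      then show ?thesis
        using has_rainbow_copy_spoke_graph[OF N(1,3) c M, of j l j' k] pq by simp
    qed
  qed
  then show ?thesis using cardV cardB by (simp add: spoke_graph_def)
qed

end

section \<open>Case distinction on \<open>K\<close> and the number of neighbours of
  \<open>u\<close>\<close>

section \<open>The linear upper bound\<close>

context pendant_graph
begin

text \<open>The clique is \<open>insert u K\<close>; its edge from \<open>u\<close> to
  \<open>b0\<close> has been rotated to the leaf \<open>v\<close>.\<close>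

lemma rotated_clique_pendant:
  assumes K: "pairs K \<subseteq> edges H" "card K \<ge> 3"
    and b0: "b0 \<in> K" "\<And>b. b \<in> K \<Longrightarrow> {u, b} \<in> edges H \<longleftrightarrow> b \<noteq> b0"
  shows "rotated_clique (card K + 1) H"
proof -
  have "edges H = insert {u, v} (pairs (insert u K) - {{u, b0}})"
  proof (intro equalityI subsetI)
    fix e assume e: "e \<in> edges H"
    then show "e \<in> insert {u, v} (pairs (insert u K) - {{u, b0}})"
    proof (cases rule: edge_cases)
      case (2 b)
      then show ?thesis using e b0(2)[of b] uv_notin_K by (auto simp: doubleton_eq_iff)
    next
      case 3
      then have "e \<in> pairs (insert u K)" using pairs_mono[of K "insert u K"] by blast
      moreover have "e \<noteq> {u, b0}" using 3 uv_notin_K by (auto simp: pairs_def)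
      ultimately show ?thesis by blast
    qed simp
  next
    fix e assume "e \<in> insert {u, v} (pairs (insert u K) - {{u, b0}})"
    then consider "e = {u, v}" | "e \<in> pairs (insert u K)" "e \<noteq> {u, b0}" by blast
    then show "e \<in> edges H"
    proof cases
      case 2
      show ?thesis
      proof (cases "u \<in> e")
        case True
        with 2(1) obtain b where b: "e = {u, b}" "b \<in> insert u K" "b \<noteq> u"
          by (rule pairs_memberE)
        then show ?thesis using 2(2) b0(2)[of b] by auto
      next
        case False
        then have "e \<in> pairs K" using 2(1) by (auto simp: pairs_def)
        then show ?thesis using K by blast
      qed
    qed (use uv in simp)
  qed
  moreover have "vertices H = insert v (insert u K)" by (simp add: vertices_eq insert_commute)
  moreover have "card (insert u K) = card K + 1" using finite_K uv_notin_K by simp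
  moreover have "u \<noteq> b0" "v \<notin> insert u K"
    using b0(1) uv_notin_K uv_vertices by auto
  ultimately have "finite (insert u K) \<and> card (insert u K) = card K + 1 \<and> u \<in> insert u K \<and>
      b0 \<in> insert u K \<and> u \<noteq> b0 \<and> v \<notin> insert u K \<and> vertices H = insert v (insert u K) \<and>
      edges H = insert {u, v} (pairs (insert u K) - {{u, b0}})"
    using finite_K b0(1) by (intro conjI) simp_all
  then have "\<exists>K' x y w. finite K' \<and> card K' = card K + 1 \<and> x \<in> K' \<and> y \<in> K' \<and> x \<noteq> y \<and> w \<notin> K' \<and>
      vertices H = insert w K' \<and> edges H = insert {x, w} (pairs K' - {{x, y}})"
    by (intro exI)
  then show ?thesis
    unfolding rotated_clique_def using K(2) by simp
qed

text \<open>The three constructions cover all values 0 < |N| < |K|, apart from the rotated cliques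
  of odd order.\<close>

lemma rainbow_sat_linear_upper:
  assumes t: "t \<ge> (card (vertices H))\<^sup>2"
    and not_rotated: "\<not> (\<exists>r. odd r \<and> r \<ge> 5 \<and> rotated_clique r H)"
  shows "\<exists>C n0. \<forall>n\<ge>n0. rainbow_sat t n H \<le> C * n"
proof -
  define N where "N = {b \<in> K. {u, b} \<in> edges H}"
  have NK: "N \<subseteq> K" and finN: "finite N" using finite_K by (auto simp: N_def)
  obtain a where a: "a \<in> N" using neighbour by (auto simp: N_def)
  obtain b0 where b0: "b0 \<in> K" "b0 \<notin> N" using nonneighbour by (auto simp: N_def)
  have N0: "card N > 0" using a finN by (auto simp: card_gt_0_iff)
  have NK': "card N < card K" using NK b0 finite_K by (intro psubset_card_mono) auto
  consider "\<not> pairs K \<subseteq> edges H \<or> card N = 1" | "pairs K \<subseteq> edges H" "2 \<le> card N" "card N + 2 \<le> card K"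
    | "pairs K \<subseteq> edges H" "2 \<le> card N" "card K = card N + 1"
    using N0 NK' by linarith
  then show ?thesis
  proof cases
    case 1
    have "\<exists>a\<in>K. \<forall>b\<in>K. {u, b} \<in> edges H \<longleftrightarrow> b = a" if "card N = 1"
    proof -
      have "N = {a}" using that a by (auto simp: card_1_singleton_iff)
      then have "\<forall>b\<in>K. {u, b} \<in> edges H \<longleftrightarrow> b = a" by (auto simp: N_def)
      then show ?thesis using a NK by blast
    qed
    then have "rainbow_sat t n H \<le> 2 * (card K + 1) * n" for n
      using rainbow_sat_le_clique_gadget[OF t] 1 by blast
    then show ?thesis by blast
  next
    case 2
    then have "\<forall>n\<ge>2 * card K. rainbow_sat t n H \<le> 2 * card K * n"
      using rainbow_sat_le_spoke_graph[OF t 2(1), of "card N"] by (simp add: N_def)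
    then show ?thesis by blast
  next
    case 3
    have "N = K - {b0}"
      using 3(3) NK b0 finite_K by (intro card_subset_eq) auto
    then have b: "{u, b} \<in> edges H \<longleftrightarrow> b \<noteq> b0" if "b \<in> K" for b
      using that by (auto simp: N_def)
    show ?thesis
    proof (cases "even (card K + 1)")
      case True
      then show ?thesis
        using rainbow_sat_le_hamming_gadget[OF t 3(1) b0(1) b] 3 by auto
    next
      case False
      \<comment> \<open>\<open>card K + 1\<close> is at least 4 and odd.\<close>
      moreover from this have "card K + 1 \<ge> 5" using 3 by presburger
      moreover from this have "rotated_clique (card K + 1) H"
        using rotated_clique_pendant[OF 3(1) _ b0(1) b] by simp
      ultimately show ?thesis
        using not_rotated by blast
    qed
  qed
qed

end

theorem theorem1p4:
  fixes H :: "'a ugraph" and t :: nat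
  assumes "simple_graph H"
    and "connected_graph H"
    and "\<not> (\<exists>v. conical_vertex H v)"
    and "\<exists>e. pendant_edge H e"
    and "\<not> (\<exists>r. odd r \<and> r \<ge> 5 \<and> rotated_clique r H)"
    and "t \<ge> (card (vertices H))\<^sup>2"
  shows "(\<lambda>n. real (rainbow_sat t n H)) \<in> \<Theta>(\<lambda>n. real n)"
proof -
  obtain e v where e: "e \<in> edges H" "v \<in> e" and leaf: "degree H v = 1"
    using assms(4) by (auto simp: pendant_edge_def)
  have "e \<in> pairs (vertices H)" using assms(1) e(1) by (auto simp: simple_graph_def)
  then obtain u where "e = {v, u}" using e(2) by (rule pairs_memberE)
  then have uv: "{u, v} \<in> edges H" using e(1) by (simp add: insert_commute)
  interpret pendant_graph H u v
    using assms(1-3) uv leaf by unfold_locales auto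
  obtain C n0 where "\<And>n. n \<ge> n0 \<Longrightarrow> rainbow_sat t n H \<le> C * n"
    using rainbow_sat_linear_upper[OF assms(6,5)] by blast
  moreover have "card (vertices H) \<ge> 3" using card_K by (simp add: card_vertices)
  moreover have "t \<ge> 1"
    using assms(6) by (rule order_trans[rotated]) (simp add: card_vertices)
  ultimately show ?thesis
    using card_edges by (intro rainbow_sat_bigtheta[OF assms(1,2)])
qed

end
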